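(* Let $x\in W$ and let $\sigma$ and $\tau$ be faces of the fundamental alcove $\mathbf c_f$ which contain the origin. Let $y\in W$ and $s\in S$. If $\ell(ys)>\ell(y)$, then $$\mathrm{Sh}_{\mathbf{ys}}(x\tau,\sigma)=\mathrm{Sh}_{\mathbf y}(x\tau,\sigma)\cup r_H\bigl(H^{ys}\cap \mathrm{Sh}_{\mathbf y}(x\tau,\sigma)\bigr),$$ where $H$ is the unique hyperplane separating the alcoves $ys\,\mathbf c_f$ and $y\,\mathbf c_f$, $r_H$ is the reflection of the apartment $A$ in $H$, $H^{ys}$ is the closed half-apartment bounded by $H$ containing $ys\,\mathbf c_f$, and $H^{ys}\cap \mathrm{Sh}_{\mathbf y}(x\tau,\sigma)$ denotes the set of simplices of $\mathrm{Sh}_{\mathbf y}(x\tau,\sigma)$ lying in $H^{ys}$.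
   Context: Let $(W,S)$ be an irreducible affine Coxeter system, $S=\{s_0,\dots,s_n\}$, acting on $n$-dimensional Euclidean space $V$ with origin $v_0$; $\ell$ is the length function. $W_0=\langle s_1,\dots,s_n\rangle$ is the stabilizer of $v_0$; $\Phi$ is a crystallographic root system with Weyl group $W_0$, simple roots $\alpha_1,\dots,\alpha_n$, highest root $\widetilde\alpha$ and coroot lattice $R^\vee$, such that $W=R^\vee\rtimes W_0$, $s_i=s_{\alpha_i}$ for $i\ge1$, and $s_0$ is the reflection in $H_{\widetilde\alpha,1}$. Hyperplanes are $H_{\alpha,k}=\{v\in V:\langle\alpha,v\rangle=k\}$, $\alpha\in\Phi$, $k\in\mathbb Z$. Alcoves are closures of connected components of the complement of all hyperplanes; the fundamental alcove $\mathbf c_f$ is bounded by $H_{\alpha_1,0},\dots,H_{\alpha_n,0},H_{\widetilde\alpha,1}$; for $x\in W$ put $\mathbf x=x\mathbf c_f$. $A$ is an apartment of an affine building of type $(W,S)$, identified with $V$. A panel is a codimension-one face of an alcove; each panel has a unique supporting hyperplane. Each simplex has a $W$-invariant type, a subset of $S$; the panel shared by $x\mathbf c_f$ and $xs\mathbf c_f$ has type $s$. A combinatorial gallery is a sequence $\gamma=(p_0,c_0,p_1,c_1,\dots,p_l,c_l,p_{l+1})$, with $c_i$ alcoves, $p_0\subseteq c_0$ and $p_{l+1}\subseteq c_l$ simplices, and for $1\le i\le l$ the face $p_i$ a panel of both $c_{i-1}$ and $c_i$. Its length is $l+1$; it is minimal if it has minimal length among galleries with first face $p_0$ and last face $p_{l+1}$.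 Its type is $(\mathrm{type}(p_0),s_{j_1},\dots,s_{j_l},\mathrm{type}(p_{l+1}))$ where $p_i$ has type $s_{j_i}$. It is folded at $p_i$ ($1\le i\le l$) if $c_{i-1}=c_i$. Fix a minimal gallery $\gamma$ in $A$ with first face $\sigma$ and last face $x\tau$. For $y\in W$, the shadow $\mathrm{Sh}_{\mathbf y}(x\tau,\sigma)$ is the set of final simplices of all galleries in $A$ of the same type as $\gamma$ which have first face $\sigma$ and are positively folded away from $\mathbf y$, meaning: whenever the gallery is folded at $p_i$, the hyperplane supporting $p_i$ separates $c_i$ from $\mathbf y$. (This is the shadow with respect to the $(J,y)$-chimney for $J=\{1,\dots,n\}$.) *)

theory Defs
  imports "HOL-Analysis.Analysis"
begin

text \<open>
  The apartment is identified with a Euclidean space \<open>'a\<close> whose origin is \<open>0\<close>.  The pairing of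
  roots with points is the inner product, so roots are vectors of \<open>'a\<close>.  Hyperplanes, alcoves and
  simplices are represented by sets of points, and elements of the affine Weyl group by maps
  \<open>'a \<Rightarrow> 'a\<close>.
\<close>

section \<open>Hyperplanes and reflections\<close>

definition hyperplane :: "'a::euclidean_space \<Rightarrow> int \<Rightarrow> 'a set" where
  "hyperplane \<alpha> k = {v. \<alpha> \<bullet> v = of_int k}"

text \<open>Orthogonal reflection; \<open>closest_point H\<close> is the orthogonal projection to \<open>H\<close>.\<close>

definition refl_in :: "'a::euclidean_space set \<Rightarrow> 'a \<Rightarrow> 'a" where
  "refl_in H v = 2 *\<^sub>R closest_point H v - v"

lemma refl_in_hyperplane:
  fixes \<alpha> :: "'a::euclidean_space"
  assumes "\<alpha> \<noteq> 0"
  shows "refl_in (hyperplane \<alpha> k) v = v - (2 * (\<alpha> \<bullet> v - of_int k) / (\<alpha> \<bullet> \<alpha>)) *\<^sub>R \<alpha>"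
proof -
  define p where "p = v - ((\<alpha> \<bullet> v - of_int k) / (\<alpha> \<bullet> \<alpha>)) *\<^sub>R \<alpha>"
  have p: "p \<in> hyperplane \<alpha> k"
    using assms by (simp add: p_def hyperplane_def inner_diff_right)
  have "dist v p \<le> dist v z" if z: "z \<in> hyperplane \<alpha> k" for z
  proof -
    have "v - p = ((\<alpha> \<bullet> v - of_int k) / (\<alpha> \<bullet> \<alpha>)) *\<^sub>R \<alpha>"
      by (simp add: p_def)
    moreover have "\<alpha> \<bullet> (p - z) = 0"
      using p z by (simp add: hyperplane_def inner_diff_right)
    ultimately have "orthogonal (v - p) (p - z)"
      by (simp add: orthogonal_def)
    then have "(norm (v - z))\<^sup>2 = (norm (v - p))\<^sup>2 + (norm (p - z))\<^sup>2"
      using norm_add_Pythagorean[of "v - p" "p - z"] by simp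
    then show ?thesis
      by (simp add: dist_norm power2_le_imp_le)
  qed
  then have "p = closest_point (hyperplane \<alpha> k) v"
    using closest_point_unique[OF _ _ p]
    by (simp add: hyperplane_def convex_hyperplane closed_hyperplane)
  then have "refl_in (hyperplane \<alpha> k) v = 2 *\<^sub>R p - v"
    by (simp add: refl_in_def)
  then show ?thesis
    unfolding p_def by (simp add: scaleR_diff_right scaleR_2 mult.assoc)
qed

section \<open>Root systems\<close>

definition root_system :: "'a::euclidean_space set \<Rightarrow> bool" where
  "root_system \<Phi> \<longleftrightarrow>
     finite \<Phi> \<and> span \<Phi> = UNIV \<and> 0 \<notin> \<Phi> \<and>
     (\<forall>\<alpha>\<in>\<Phi>. refl_in (hyperplane \<alpha> 0) ` \<Phi> = \<Phi>) \<and>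
     (\<forall>\<alpha>\<in>\<Phi>. \<Phi> \<inter> span {\<alpha>} = {\<alpha>, - \<alpha>})"

definition crystallographic :: "'a::euclidean_space set \<Rightarrow> bool" where
  "crystallographic \<Phi> \<longleftrightarrow> (\<forall>\<alpha>\<in>\<Phi>. \<forall>\<beta>\<in>\<Phi>. 2 * (\<alpha> \<bullet> \<beta>) / (\<alpha> \<bullet> \<alpha>) \<in> \<int>)"

definition irreducible_roots :: "'a::euclidean_space set \<Rightarrow> bool" where
  "irreducible_roots \<Phi> \<longleftrightarrow>
     \<Phi> \<noteq> {} \<and>
     \<not> (\<exists>A B. A \<noteq> {} \<and> B \<noteq> {} \<and> A \<inter> B = {} \<and> A \<union> B = \<Phi> \<and>
              (\<forall>\<alpha>\<in>A. \<forall>\<beta>\<in>B. orthogonal \<alpha> \<beta>))"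

definition nat_combs :: "'a::euclidean_space set \<Rightarrow> 'a set" where
  "nat_combs \<Delta> = {\<Sum>\<alpha>\<in>\<Delta>. real (m \<alpha>) *\<^sub>R \<alpha> | m :: 'a \<Rightarrow> nat. True}"

definition simple_roots :: "'a::euclidean_space set \<Rightarrow> 'a set \<Rightarrow> bool" where
  "simple_roots \<Phi> \<Delta> \<longleftrightarrow>
     \<Delta> \<subseteq> \<Phi> \<and> independent \<Delta> \<and> (\<forall>\<beta>\<in>\<Phi>. \<beta> \<in> nat_combs \<Delta> \<or> - \<beta> \<in> nat_combs \<Delta>)"

definition highest_root :: "'a::euclidean_space set \<Rightarrow> 'a set \<Rightarrow> 'a \<Rightarrow> bool" where
  "highest_root \<Phi> \<Delta> \<theta> \<longleftrightarrow> \<theta> \<in> \<Phi> \<and> (\<forall>\<beta>\<in>\<Phi>. \<theta> - \<beta> \<in> nat_combs \<Delta>)"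

section \<open>The affine Coxeter system\<close>

text \<open>The generating set \<open>S = {s\<^sub>0, \<dots>, s\<^sub>n}\<close>; the reflection in \<open>hyperplane \<theta> 1\<close> is \<open>s\<^sub>0\<close>.\<close>

definition simple_refls :: "'a::euclidean_space set \<Rightarrow> 'a \<Rightarrow> ('a \<Rightarrow> 'a) set" where
  "simple_refls \<Delta> \<theta> =
     insert (refl_in (hyperplane \<theta> 1)) ((\<lambda>\<alpha>. refl_in (hyperplane \<alpha> 0)) ` \<Delta>)"

definition word_prod :: "('a \<Rightarrow> 'a) list \<Rightarrow> 'a \<Rightarrow> 'a" where
  "word_prod ws = foldr (\<circ>) ws id"

text \<open>The generators are involutions, so words in them already form the group they generate.\<close>

definition affine_weyl_group :: "'a::euclidean_space set \<Rightarrow> 'a \<Rightarrow> ('a \<Rightarrow> 'a) set" where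
  "affine_weyl_group \<Delta> \<theta> = word_prod ` lists (simple_refls \<Delta> \<theta>)"

definition coxeter_length :: "'a::euclidean_space set \<Rightarrow> 'a \<Rightarrow> ('a \<Rightarrow> 'a) \<Rightarrow> nat" where
  "coxeter_length \<Delta> \<theta> w =
     (LEAST k. \<exists>ws \<in> lists (simple_refls \<Delta> \<theta>). length ws = k \<and> word_prod ws = w)"

section \<open>Alcoves and simplices\<close>

definition hyperplanes :: "'a::euclidean_space set \<Rightarrow> 'a set set" where
  "hyperplanes \<Phi> = {hyperplane \<alpha> k | \<alpha> k. \<alpha> \<in> \<Phi>}"

definition alcoves :: "'a::euclidean_space set \<Rightarrow> 'a set set" where
  "alcoves \<Phi> = closure ` components (- \<Union> (hyperplanes \<Phi>))"

definition fund_alcove :: "'a::euclidean_space set \<Rightarrow> 'a \<Rightarrow> 'a set" where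
  "fund_alcove \<Delta> \<theta> = {v. (\<forall>\<alpha>\<in>\<Delta>. 0 \<le> \<alpha> \<bullet> v) \<and> \<theta> \<bullet> v \<le> 1}"

definition simplices :: "'a::euclidean_space set \<Rightarrow> 'a set set" where
  "simplices \<Phi> = {F. F \<noteq> {} \<and> (\<exists>C\<in>alcoves \<Phi>. F face_of C)}"

text \<open>
  The type of a simplex is the set of those \<open>s\<close> that fix its translate \<open>G\<close> in the fundamental
  alcove.  Thus the common panel of \<open>x c\<^sub>f\<close> and \<open>x s c\<^sub>f\<close> has type \<open>{s}\<close>, and alcoves have empty
  type.  There is exactly one such \<open>G\<close>, since the fundamental alcove is a strict fundamental domain.
\<close>

definition simplex_type ::
    "'a::euclidean_space set \<Rightarrow> 'a \<Rightarrow> 'a set \<Rightarrow> ('a \<Rightarrow> 'a) set" where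
  "simplex_type \<Delta> \<theta> F =
     {s \<in> simple_refls \<Delta> \<theta>.
        \<exists>w \<in> affine_weyl_group \<Delta> \<theta>. \<exists>G. G face_of fund_alcove \<Delta> \<theta> \<and> F = w ` G \<and>
          (\<forall>v\<in>G. s v = v)}"

definition separates :: "'a::euclidean_space set \<Rightarrow> 'a set \<Rightarrow> 'a set \<Rightarrow> bool" where
  "separates H C D \<longleftrightarrow>
     (\<exists>a b. a \<noteq> 0 \<and> H = {v. a \<bullet> v = b} \<and> C \<subseteq> {v. a \<bullet> v \<le> b} \<and> D \<subseteq> {v. a \<bullet> v \<ge> b})"

definition separating_hyperplane ::
    "'a::euclidean_space set \<Rightarrow> 'a set \<Rightarrow> 'a set \<Rightarrow> 'a set" where
  "separating_hyperplane \<Phi> C D = (THE H. H \<in> hyperplanes \<Phi> \<and> separates H C D)"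

definition supporting_hyperplane :: "'a::euclidean_space set \<Rightarrow> 'a set \<Rightarrow> 'a set" where
  "supporting_hyperplane \<Phi> p = (THE H. H \<in> hyperplanes \<Phi> \<and> p \<subseteq> H)"

definition half_apartment :: "'a::euclidean_space set \<Rightarrow> 'a set \<Rightarrow> 'a set" where
  "half_apartment H C =
     (THE D. (\<exists>a b. a \<noteq> 0 \<and> H = {v. a \<bullet> v = b} \<and> D = {v. a \<bullet> v \<le> b}) \<and> C \<subseteq> D)"

section \<open>Galleries\<close>

text \<open>
  A gallery \<open>(p\<^sub>0, c\<^sub>0, p\<^sub>1, \<dots>, p\<^sub>l, c\<^sub>l, p\<^bsub>l+1\<^esub>)\<close> is stored as the pair of lists
  \<open>([p\<^sub>0, \<dots>, p\<^bsub>l+1\<^esub>], [c\<^sub>0, \<dots>, c\<^sub>l])\<close>.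
\<close>

type_synonym 'a gallery = "'a set list \<times> 'a set list"

definition faces :: "'a gallery \<Rightarrow> 'a set list" where
  "faces \<gamma> = fst \<gamma>"

definition chambers :: "'a gallery \<Rightarrow> 'a set list" where
  "chambers \<gamma> = snd \<gamma>"

definition first_face :: "'a gallery \<Rightarrow> 'a set" where
  "first_face \<gamma> = hd (faces \<gamma>)"

definition last_face :: "'a gallery \<Rightarrow> 'a set" where
  "last_face \<gamma> = last (faces \<gamma>)"

definition gallery_length :: "'a gallery \<Rightarrow> nat" where
  "gallery_length \<gamma> = length (chambers \<gamma>)"

definition is_gallery :: "'a::euclidean_space set \<Rightarrow> 'a gallery \<Rightarrow> bool" where
  "is_gallery \<Phi> \<gamma> \<longleftrightarrow>
     chambers \<gamma> \<noteq> [] \<and> length (faces \<gamma>) = length (chambers \<gamma>) + 1 \<and>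
     set (chambers \<gamma>) \<subseteq> alcoves \<Phi> \<and>
     first_face \<gamma> \<in> simplices \<Phi> \<and> first_face \<gamma> \<subseteq> hd (chambers \<gamma>) \<and>
     last_face \<gamma> \<in> simplices \<Phi> \<and> last_face \<gamma> \<subseteq> last (chambers \<gamma>) \<and>
     (\<forall>i \<in> {1..<length (chambers \<gamma>)}.
        faces \<gamma> ! i facet_of chambers \<gamma> ! (i - 1) \<and> faces \<gamma> ! i facet_of chambers \<gamma> ! i)"

definition minimal_gallery :: "'a::euclidean_space set \<Rightarrow> 'a gallery \<Rightarrow> bool" where
  "minimal_gallery \<Phi> \<gamma> \<longleftrightarrow>
     is_gallery \<Phi> \<gamma> \<and>
     (\<forall>\<gamma>'. is_gallery \<Phi> \<gamma>' \<and> first_face \<gamma>' = first_face \<gamma> \<and> last_face \<gamma>' = last_face \<gamma> \<longrightarrow>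
           gallery_length \<gamma> \<le> gallery_length \<gamma>')"

definition gallery_type ::
    "'a::euclidean_space set \<Rightarrow> 'a \<Rightarrow> 'a gallery \<Rightarrow> ('a \<Rightarrow> 'a) set list" where
  "gallery_type \<Delta> \<theta> \<gamma> = map (simplex_type \<Delta> \<theta>) (faces \<gamma>)"

definition folded_at :: "'a gallery \<Rightarrow> nat \<Rightarrow> bool" where
  "folded_at \<gamma> i \<longleftrightarrow>
     1 \<le> i \<and> i < length (chambers \<gamma>) \<and> chambers \<gamma> ! (i - 1) = chambers \<gamma> ! i"

text \<open>Positively folded away from the alcove \<open>D\<close>.\<close>

definition positively_folded ::
    "'a::euclidean_space set \<Rightarrow> 'a set \<Rightarrow> 'a gallery \<Rightarrow> bool" where
  "positively_folded \<Phi> D \<gamma> \<longleftrightarrow>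
     (\<forall>i. folded_at \<gamma> i \<longrightarrow>
        separates (supporting_hyperplane \<Phi> (faces \<gamma> ! i)) (chambers \<gamma> ! i) D)"

text \<open>
  The shadow with respect to the alcove \<open>y c\<^sub>f\<close>.  The minimal gallery \<open>\<gamma>\<close> is an explicit argument;
  the first and last face of \<open>\<gamma>\<close> are the simplices \<open>\<sigma>\<close> and \<open>x \<tau>\<close>.
\<close>

definition shadow ::
    "'a::euclidean_space set \<Rightarrow> 'a set \<Rightarrow> 'a \<Rightarrow> 'a gallery \<Rightarrow> ('a \<Rightarrow> 'a) \<Rightarrow> 'a set set" where
  "shadow \<Phi> \<Delta> \<theta> \<gamma> y =
     {last_face \<delta> | \<delta>.
        is_gallery \<Phi> \<delta> \<and> gallery_type \<Delta> \<theta> \<delta> = gallery_type \<Delta> \<theta> \<gamma> \<and>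
        first_face \<delta> = first_face \<gamma> \<and> positively_folded \<Phi> (y ` fund_alcove \<Delta> \<theta>) \<delta>}"

end

theory Submission
  imports Defs
begin

text \<open>
  Let \<open>r\<close> be the reflection in \<open>H\<close>.  Only foldings at \<open>H\<close> are affected when \<open>y c\<^sub>f\<close> is replaced by
  \<open>y s c\<^sub>f\<close>, since no other hyperplane separates these two alcoves, and since \<open>r\<close> interchanges them,
  foldings at other hyperplanes remain positive when a segment of a gallery is reflected.  So in a
  gallery folded positively away from one of the two alcoves, choose an interval of positions and
  reflect in \<open>H\<close> those of its chambers that lie on the wrong side: inside the interval all foldings
  at \<open>H\<close> become positive for the other alcove, and a folding at \<open>H\<close> at an end of the interval
  becomes a crossing.  Taking everything up to the last folding at \<open>H\<close> keeps the final simplex,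
  taking everything moves it to one side of \<open>H\<close>, and taking everything from the first folding at \<open>H\<close>
  on gives the converse inclusion.  The first simplex stays in place because, by the exchange
  property, \<open>\<ell>(ys) > \<ell>(y)\<close> forces \<open>c\<^sub>f\<close> to lie on the side of \<open>H\<close> containing \<open>y c\<^sub>f\<close>.
\<close>

section \<open>Sides of hyperplanes and rigid motions\<close>

text \<open>Moving inside the first hyperplane along \<open>u\<close>, the part of \<open>c\<close>
  orthogonal to \<open>a\<close>, must not change the value of \<open>c\<close>, so
  \<open>u = 0\<close>. Since \<open>separates\<close>, \<open>uncut\<close> and
  \<open>half_apartment\<close> quantify over all equations of a hyperplane, this is what allows
  working with one fixed equation.\<close>

lemma hyperplane_subset_imp_scaled:
  fixes a c :: "'a::euclidean_space"
  assumes "a \<noteq> 0" "c \<noteq> 0" and sub: "{v. a \<bullet> v = b} \<subseteq> {v. c \<bullet> v = d}"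
  obtains r where "r \<noteq> 0" "c = r *\<^sub>R a" "d = r * b"
proof -
  define p where "p = (b / (a \<bullet> a)) *\<^sub>R a"
  define r where "r = (c \<bullet> a) / (a \<bullet> a)"
  define u where "u = c - r *\<^sub>R a"
  have "a \<bullet> p = b" using assms by (simp add: p_def)
  have "a \<bullet> u = 0" using assms by (simp add: u_def r_def inner_diff_right inner_commute)
  then have "c \<bullet> (p + u) = d"
    using subsetD[OF sub, of "p + u"] \<open>a \<bullet> p = b\<close> by (simp add: inner_add_right)
  moreover have "c \<bullet> p = d" using sub \<open>a \<bullet> p = b\<close> by auto
  ultimately have "c \<bullet> u = 0" by (simp add: inner_add_right)
  with \<open>a \<bullet> u = 0\<close> have "u \<bullet> u = 0" by (simp add: u_def inner_diff_left)
  then have c: "c = r *\<^sub>R a" by (simp add: u_def)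
  moreover have "d = r * b" using \<open>c \<bullet> p = d\<close> \<open>a \<bullet> p = b\<close> c by auto
  moreover have "r \<noteq> 0" using c assms by auto
  ultimately show ?thesis using that by blast
qed

text \<open>One inequality covers both sides, since \<open>a\<close> and \<open>b\<close> may both
  change sign. The nonempty interior excludes sets inside \<open>K\<close>, so that the side is
  unique.\<close>

definition uncut :: "'a::euclidean_space set \<Rightarrow> 'a set \<Rightarrow> bool" where
  "uncut K C \<longleftrightarrow> interior C \<noteq> {} \<and>
     (\<exists>a b. a \<noteq> 0 \<and> K = {v. a \<bullet> v = b} \<and> C \<subseteq> {v. a \<bullet> v \<le> b})"

lemma not_in_hyperplane_if_interior:
  fixes C :: "'a::euclidean_space set"
  assumes "interior C \<noteq> {}" "a \<noteq> 0"
  shows "\<not> C \<subseteq> {v. a \<bullet> v = b}"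
  using assms interior_hyperplane[of a b] interior_mono[of C "{v. a \<bullet> v = b}"] by auto

lemma separates_iff:
  fixes C D :: "'a::euclidean_space set"
  assumes "a \<noteq> 0"
  shows "separates {v. a \<bullet> v = b} C D \<longleftrightarrow>
    (\<forall>u\<in>C. a \<bullet> u \<le> b) \<and> (\<forall>u\<in>D. b \<le> a \<bullet> u) \<or> (\<forall>u\<in>C. b \<le> a \<bullet> u) \<and> (\<forall>u\<in>D. a \<bullet> u \<le> b)"
    (is "?L \<longleftrightarrow> ?R")
proof
  assume ?L
  then obtain c d where c: "c \<noteq> 0" "{v. a \<bullet> v = b} = {v. c \<bullet> v = d}"
    "\<forall>u\<in>C. c \<bullet> u \<le> d" "\<forall>u\<in>D. d \<le> c \<bullet> u"
    unfolding separates_def by blast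
  obtain r where r: "r \<noteq> 0" "c = r *\<^sub>R a" "d = r * b"
    using hyperplane_subset_imp_scaled[of a c b d] assms c by blast
  show ?R
    using c(3,4) r by (cases "r > 0") (auto simp: mult_le_cancel_left)
next
  assume ?R
  then show ?L
  proof
    assume "(\<forall>u\<in>C. a \<bullet> u \<le> b) \<and> (\<forall>u\<in>D. b \<le> a \<bullet> u)"
    then show ?L unfolding separates_def using assms by (intro exI[of _ a] exI[of _ b]) auto
  next
    assume "(\<forall>u\<in>C. b \<le> a \<bullet> u) \<and> (\<forall>u\<in>D. a \<bullet> u \<le> b)"
    then show ?L unfolding separates_def using assms
      by (intro exI[of _ "-a"] exI[of _ "-b"]) auto
  qed
qed

lemma separates_commute: "separates K C D \<longleftrightarrow> separates K D C"
proof -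
  have "separates K D C" if "separates K C D" for C D :: "'a set"
  proof -
    from that obtain a b where "a \<noteq> 0" "K = {v. a \<bullet> v = b}" unfolding separates_def by blast
    with that show ?thesis by (auto simp: separates_iff)
  qed
  then show ?thesis by blast
qed

lemma separates_Int_subset: "separates K C D \<Longrightarrow> C \<inter> D \<subseteq> K"
  unfolding separates_def by force

lemma uncut_cases:
  assumes "uncut {v. a \<bullet> v = b} C" "a \<noteq> 0"
  shows "(\<forall>u\<in>C. a \<bullet> u \<le> b) \<or> (\<forall>u\<in>C. b \<le> a \<bullet> u)"
proof -
  from assms obtain c d where c: "c \<noteq> 0" "{v. a \<bullet> v = b} = {v. c \<bullet> v = d}"
    "\<forall>u\<in>C. c \<bullet> u \<le> d"
    unfolding uncut_def by blast
  obtain r where r: "r \<noteq> 0" "c = r *\<^sub>R a" "d = r * b"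
    using hyperplane_subset_imp_scaled[of a c b d] assms c by blast
  show ?thesis
    using c(3) r by (cases "r > 0") (auto simp: mult_le_cancel_left)
qed

lemma not_separates_self: "uncut K C \<Longrightarrow> \<not> separates K C C"
  unfolding uncut_def using separates_Int_subset not_in_hyperplane_if_interior by fastforce

text \<open>Each of the three sets lies on exactly one side of \<open>K\<close>, so being separated
  is addition modulo 2. Later changes of the reference alcove rest on this rule.\<close>

lemma separates_uncut:
  assumes "uncut K C" "uncut K D" "uncut K E"
  shows "separates K C E \<longleftrightarrow> (separates K C D \<longleftrightarrow> \<not> separates K D E)"
proof -
  obtain a b where K: "a \<noteq> 0" "K = {v. a \<bullet> v = b}" using assms unfolding uncut_def by blast
  have "\<not> ((\<forall>u\<in>X. a \<bullet> u \<le> b) \<and> (\<forall>u\<in>X. b \<le> a \<bullet> u))" if "uncut K X" for X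
    using not_in_hyperplane_if_interior[of X a b] that K unfolding uncut_def by force
  then show ?thesis
    using assms uncut_cases[of a b] unfolding K(2) separates_iff[OF K(1)]
    using K(1) by metis
qed

text \<open>A negative factor between two equations would push \<open>C\<close> into the hyperplane
  itself, against its interior; hence the definite description picks a unique half-space.\<close>

lemma half_apartment_eq:
  assumes "a \<noteq> 0" "interior C \<noteq> {}" "C \<subseteq> {v. a \<bullet> v \<le> b}"
  shows "half_apartment {v. a \<bullet> v = b} C = {v. a \<bullet> v \<le> b}"
  unfolding half_apartment_def
proof (rule the_equality)
  fix D
  assume D: "(\<exists>c d. c \<noteq> 0 \<and> {v. a \<bullet> v = b} = {v. c \<bullet> v = d} \<and> D = {v. c \<bullet> v \<le> d}) \<and> C \<subseteq> D"
  then obtain c d where c: "c \<noteq> 0" "{v. a \<bullet> v = b} = {v. c \<bullet> v = d}" "D = {v. c \<bullet> v \<le> d}"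
    by blast
  obtain r where r: "r \<noteq> 0" "c = r *\<^sub>R a" "d = r * b"
    using hyperplane_subset_imp_scaled[of a c b d] assms c by blast
  have "r > 0"
  proof (rule ccontr)
    assume "\<not> r > 0"
    then have "r < 0" using r(1) by simp
    then have "C \<subseteq> {v. b \<le> a \<bullet> v}"
      using conjunct2[OF D] unfolding c(3) r by (simp add: mult_le_cancel_left)
    then have "C \<subseteq> {v. a \<bullet> v = b}" using assms(3) by force
    then show False using not_in_hyperplane_if_interior assms by blast
  qed
  then show "D = {v. a \<bullet> v \<le> b}" using c(3) r by (auto simp: mult_le_cancel_left)
qed (use assms in blast)

text \<open>The second claim is meant for faces of a chamber on the far side: if such a face lies in
  the half-apartment at all, it lies in the wall.\<close>

lemma half_apartment_uncut:
  assumes "uncut K D" "uncut K C"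
  shows "\<not> separates K C D \<Longrightarrow> C \<subseteq> half_apartment K D"
    and "separates K C D \<Longrightarrow> C \<inter> half_apartment K D \<subseteq> K"
proof -
  obtain a b where K: "a \<noteq> 0" "K = {v. a \<bullet> v = b}" "D \<subseteq> {v. a \<bullet> v \<le> b}"
    using assms unfolding uncut_def by blast
  have h: "half_apartment K D = {v. a \<bullet> v \<le> b}"
    using half_apartment_eq[of a D b] K assms unfolding uncut_def by blast
  have *: "\<not> ((\<forall>u\<in>D. b \<le> a \<bullet> u))"
    using not_in_hyperplane_if_interior[of D a b] assms K unfolding uncut_def by force
  show "\<not> separates K C D \<Longrightarrow> C \<subseteq> half_apartment K D"
    using uncut_cases[of a b C] assms * K unfolding h unfolding K(2) separates_iff[OF K(1)]
    by auto
  show "separates K C D \<Longrightarrow> C \<inter> half_apartment K D \<subseteq> K"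
    using * unfolding h unfolding K(2) separates_iff[OF K(1)] by force
qed

section \<open>Rigid motions and what they preserve\<close>

definition motion :: "('a::euclidean_space \<Rightarrow> 'a) \<Rightarrow> bool" where
  "motion g \<longleftrightarrow> (\<exists>L t. orthogonal_transformation L \<and> g = (\<lambda>v. t + L v))"

lemma motion_id: "motion id"
  unfolding motion_def
  by (intro exI[of _ "\<lambda>x. x"] exI[of _ 0]) (auto simp: orthogonal_transformation_id)

lemma motion_comp:
  assumes "motion g" "motion h"
  shows "motion (g \<circ> h)"
proof -
  obtain L t M u where g: "orthogonal_transformation L" "g = (\<lambda>v. t + L v)"
    and h: "orthogonal_transformation M" "h = (\<lambda>v. u + M v)"
    using assms unfolding motion_def by blast
  have "g \<circ> h = (\<lambda>v. (t + L u) + (L \<circ> M) v)"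
    using g(2) h(2) linear_add[OF orthogonal_transformation_linear[OF g(1)]] by (auto simp: fun_eq_iff)
  then show ?thesis
    unfolding motion_def using orthogonal_transformation_compose[OF g(1) h(1)] by blast
qed

lemma refl_linear_part:
  fixes \<alpha> :: "'a::euclidean_space"
  assumes "\<alpha> \<noteq> 0"
  shows "orthogonal_transformation (refl_in (hyperplane \<alpha> 0))"
proof -
  have e: "refl_in (hyperplane \<alpha> 0) = (\<lambda>v. v - (2 * (\<alpha> \<bullet> v) / (\<alpha> \<bullet> \<alpha>)) *\<^sub>R \<alpha>)"
    using refl_in_hyperplane[OF assms, of 0] by auto
  show ?thesis
    unfolding orthogonal_transformation_def e
  proof (intro conjI allI)
    show "linear (\<lambda>v. v - (2 * (\<alpha> \<bullet> v) / (\<alpha> \<bullet> \<alpha>)) *\<^sub>R \<alpha>)"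
      by (rule linearI)
        (simp_all add: inner_add_right distrib_left add_divide_distrib scaleR_add_left
          scaleR_diff_right)
    fix v w
    show "(v - (2 * (\<alpha> \<bullet> v) / (\<alpha> \<bullet> \<alpha>)) *\<^sub>R \<alpha>) \<bullet> (w - (2 * (\<alpha> \<bullet> w) / (\<alpha> \<bullet> \<alpha>)) *\<^sub>R \<alpha>) = v \<bullet> w"
      using assms by (simp add: inner_diff_left inner_diff_right inner_commute field_simps)
  qed
qed

lemma motion_refl_in:
  fixes \<alpha> :: "'a::euclidean_space"
  assumes "\<alpha> \<noteq> 0"
  shows "motion (refl_in (hyperplane \<alpha> k))"
proof -
  have "refl_in (hyperplane \<alpha> k) =
      (\<lambda>v. (2 * of_int k / (\<alpha> \<bullet> \<alpha>)) *\<^sub>R \<alpha> + refl_in (hyperplane \<alpha> 0) v)"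
    using assms
    by (auto simp: refl_in_hyperplane fun_eq_iff diff_divide_distrib right_diff_distrib scaleR_diff_left)
  then show ?thesis
    unfolding motion_def using refl_linear_part[OF assms] by blast
qed

lemma refl_in_involution:
  fixes \<alpha> :: "'a::euclidean_space"
  assumes "\<alpha> \<noteq> 0"
  shows "refl_in (hyperplane \<alpha> k) (refl_in (hyperplane \<alpha> k) v) = v"
  using assms
  by (simp add: refl_in_hyperplane inner_diff_right scaleR_left_diff_distrib[symmetric]
      scaleR_left.add[symmetric] field_simps flip: scaleR_left.add)

lemma refl_in_fix_iff:
  fixes \<alpha> :: "'a::euclidean_space"
  assumes "\<alpha> \<noteq> 0"
  shows "refl_in (hyperplane \<alpha> k) v = v \<longleftrightarrow> v \<in> hyperplane \<alpha> k"
  using assms by (simp add: refl_in_hyperplane) (simp add: hyperplane_def)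

context
  fixes g :: "'a::euclidean_space \<Rightarrow> 'a"
  assumes g: "motion g"
begin

lemma motion_dist: "dist (g u) (g v) = dist u v"
proof -
  from g obtain L t where L: "orthogonal_transformation L" "g = (\<lambda>v. t + L v)"
    unfolding motion_def by blast
  then show ?thesis
    using linear_diff[OF orthogonal_transformation_linear[OF L(1)], of u v]
      orthogonal_transformation_norm[OF L(1), of "u - v"]
    by (simp add: dist_norm)
qed

lemma motion_bij: "bij g"
proof -
  from g obtain L t where L: "orthogonal_transformation L" "g = (+) t \<circ> L"
    unfolding motion_def by (auto simp: fun_eq_iff comp_def)
  then show ?thesis
    using orthogonal_transformation_bij[OF L(1)] bij_comp[of L "(+) t"] by simp
qed

lemma motion_image:
  obtains L t where "orthogonal_transformation L" "\<And>S. g ` S = (+) t ` L ` S"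
  using g unfolding motion_def by (auto simp: image_image)

lemma motion_face_of: "g ` F face_of g ` C \<longleftrightarrow> F face_of C"
  by (rule motion_image)
    (simp add: face_of_translation_eq face_of_linear_image orthogonal_transformation_linear
      orthogonal_transformation_inj)

lemma motion_aff_dim: "aff_dim (g ` C) = aff_dim C"
  by (rule motion_image)
    (simp add: aff_dim_translation_eq aff_dim_injective_linear_image
      orthogonal_transformation_linear orthogonal_transformation_inj)

lemma motion_facet_of: "g ` F facet_of g ` C \<longleftrightarrow> F facet_of C"
  unfolding facet_of_def motion_face_of motion_aff_dim by simp

lemma motion_closure: "closure (g ` C) = g ` closure C"
  by (rule motion_image)
    (simp add: closure_translation closure_injective_linear_image
      orthogonal_transformation_linear orthogonal_transformation_inj)

lemma motion_interior: "interior (g ` C) = g ` interior C"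
  by (rule motion_image)
    (simp add: interior_translation interior_injective_linear_image
      orthogonal_transformation_linear orthogonal_transformation_inj)

lemma motion_continuous: "continuous_on S g"
proof -
  have "uniformly_continuous_on S g"
    unfolding uniformly_continuous_on_def using motion_dist by auto
  then show ?thesis by (rule uniformly_continuous_imp_continuous)
qed

text \<open>The new normal is \<open>L a\<close>, with offset \<open>b + L a \<bullet> t\<close>.
  The value of the defining function is preserved, not only its zero set, so sides are carried along
  with hyperplanes.\<close>

lemma motion_inner:
  assumes "a \<noteq> 0"
  obtains a' b' where "a' \<noteq> 0" "\<And>v. a' \<bullet> g v - b' = a \<bullet> v - b"
proof -
  from g obtain L t where L: "orthogonal_transformation L" "g = (\<lambda>v. t + L v)"
    unfolding motion_def by blast
  have "L a \<noteq> 0"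
    using assms orthogonal_transformation_norm[OF L(1), of a] by auto
  moreover have "L a \<bullet> g v - (b + L a \<bullet> t) = a \<bullet> v - b" for v
    using L by (simp add: inner_add_right orthogonal_transformation_def)
  ultimately show ?thesis using that by blast
qed

lemma motion_hyperplane_image:
  assumes "\<And>v. a' \<bullet> g v - b' = a \<bullet> v - b"
  shows "g ` {v. a \<bullet> v = b} = {v. a' \<bullet> v = b'}"
proof -
  have "u \<in> g ` {v. a \<bullet> v = b} \<longleftrightarrow> u \<in> {v. a' \<bullet> v = b'}" for u
  proof -
    obtain v where "u = g v" using bij_is_surj[OF motion_bij] by auto
    then show ?thesis using assms[of v] bij_is_inj[OF motion_bij] by (auto simp: inj_image_mem_iff)
  qed
  then show ?thesis by blast
qed

lemma motion_separates:
  assumes "separates K C D"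
  shows "separates (g ` K) (g ` C) (g ` D)"
proof -
  obtain a b where K: "a \<noteq> 0" "K = {v. a \<bullet> v = b}" "C \<subseteq> {v. a \<bullet> v \<le> b}" "D \<subseteq> {v. a \<bullet> v \<ge> b}"
    using assms unfolding separates_def by blast
  obtain a' b' where a': "a' \<noteq> 0" "\<And>v. a' \<bullet> g v - b' = a \<bullet> v - b"
    using motion_inner[OF K(1)] by blast
  have "a' \<bullet> g v \<le> b' \<longleftrightarrow> a \<bullet> v \<le> b" "b' \<le> a' \<bullet> g v \<longleftrightarrow> b \<le> a \<bullet> v" for v
    using a'(2)[of v] by linarith+
  then show ?thesis
    unfolding K(2) motion_hyperplane_image[OF a'(2)] separates_iff[OF a'(1)] using K(3,4) by auto
qed

lemma motion_uncut:
  assumes "uncut K C"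
  shows "uncut (g ` K) (g ` C)"
proof -
  obtain a b where K: "a \<noteq> 0" "K = {v. a \<bullet> v = b}" "C \<subseteq> {v. a \<bullet> v \<le> b}"
    using assms unfolding uncut_def by blast
  obtain a' b' where a': "a' \<noteq> 0" "\<And>v. a' \<bullet> g v - b' = a \<bullet> v - b"
    using motion_inner[OF K(1)] by blast
  have "a' \<bullet> g v \<le> b' \<longleftrightarrow> a \<bullet> v \<le> b" for v
    using a'(2)[of v] by linarith
  then have "g ` C \<subseteq> {v. a' \<bullet> v \<le> b'}" using K(3) by auto
  then show ?thesis
    using assms a'(1) motion_hyperplane_image[OF a'(2)] K(2) unfolding uncut_def motion_interior
    by (metis image_is_empty)
qed

text \<open>An isometry takes closest points to closest points, by uniqueness of the projection, and
  an affine map respects the combination \<open>2 p - v\<close>.\<close>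

lemma motion_refl_in_conj:
  assumes "convex K" "closed K" "K \<noteq> {}" "convex (g ` K)" "closed (g ` K)"
  shows "refl_in (g ` K) (g v) = g (refl_in K v)"
proof -
  have "g (closest_point K v) = closest_point (g ` K) (g v)"
    using assms closest_point_le[OF assms(2)] closest_point_in_set[OF assms(2,3)]
    by (intro closest_point_unique) (auto simp: motion_dist)
  moreover have "g (2 *\<^sub>R p - v) = 2 *\<^sub>R g p - g v" for p
  proof -
    from g obtain L t where L: "orthogonal_transformation L" "g = (\<lambda>v. t + L v)"
      unfolding motion_def by blast
    note linear = orthogonal_transformation_linear[OF L(1)]
    show ?thesis
      unfolding L(2) linear_diff[OF linear] linear_cmul[OF linear]
      by (simp add: scaleR_2)
  qed
  ultimately show ?thesis unfolding refl_in_def by simp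
qed

end

section \<open>The arrangement and the affine Weyl group\<close>

lemma uncutI:
  assumes "a \<noteq> 0" "interior C \<noteq> {}" "(\<forall>u\<in>C. a \<bullet> u \<le> b) \<or> (\<forall>u\<in>C. b \<le> a \<bullet> u)"
  shows "uncut {v. a \<bullet> v = b} C"
  using assms(3)
proof
  assume "\<forall>u\<in>C. a \<bullet> u \<le> b"
  then show ?thesis unfolding uncut_def using assms by (intro conjI exI[of _ a] exI[of _ b]) auto
next
  assume "\<forall>u\<in>C. b \<le> a \<bullet> u"
  then show ?thesis
    unfolding uncut_def using assms by (intro conjI exI[of _ "-a"] exI[of _ "-b"]) auto
qed

text \<open>A connected set containing the image of \<open>X\<close> is pulled back by the inverse
  map \<open>h\<close> to one containing \<open>X\<close>, where the maximality of \<open>X\<close>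
  applies.\<close>

lemma components_image:
  assumes X: "X \<in> components S" and "g ` S \<subseteq> S" "h ` S \<subseteq> S"
    and "continuous_on S g" "continuous_on S h" and "\<And>v. g (h v) = v" "\<And>v. h (g v) = v"
  shows "g ` X \<in> components S"
  unfolding in_components_maximal
proof (intro conjI allI impI)
  note X' = in_components_nonempty[OF X] in_components_subset[OF X] in_components_connected[OF X]
  have maximal: "D = X" if "D \<noteq> {}" "X \<subseteq> D" "D \<subseteq> S" "connected D" for D
    using that X unfolding in_components_maximal by simp
  show "g ` X \<noteq> {}" "g ` X \<subseteq> S" using X' assms by auto
  show "connected (g ` X)"
    using connected_continuous_image[OF continuous_on_subset[OF assms(4) X'(2)] X'(3)] .
  fix D
  assume D: "D \<noteq> {} \<and> g ` X \<subseteq> D \<and> D \<subseteq> S \<and> connected D"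
  have "h ` D = X"
  proof (rule maximal)
    show "connected (h ` D)"
      using D connected_continuous_image[OF continuous_on_subset[OF assms(5)]] by simp
    have "h ` g ` X = X" by (simp add: image_image assms(7))
    then show "X \<subseteq> h ` D" using D image_mono[of "g ` X" D h] by simp
    show "h ` D \<subseteq> S" using D assms(3) by (meson image_mono subset_trans)
  qed (use D in simp)
  then have "g ` h ` D = g ` X" by simp
  then show "D = g ` X" by (simp add: image_image assms(6))
qed

lemma word_prod_Nil [simp]: "word_prod [] = id"
  and word_prod_Cons [simp]: "word_prod (s # ws) = s \<circ> word_prod ws"
  by (simp_all add: word_prod_def)

section \<open>Root data and the reflection-invariant arrangement\<close>

locale affine_roots =
  fixes \<Phi> \<Delta> :: "'a::euclidean_space set" and \<theta> :: 'a
  assumes roots: "root_system \<Phi>" and crys: "crystallographic \<Phi>"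
    and simple: "simple_roots \<Phi> \<Delta>" and highest: "highest_root \<Phi> \<Delta> \<theta>"
begin

abbreviation "W \<equiv> affine_weyl_group \<Delta> \<theta>"
abbreviation "S \<equiv> simple_refls \<Delta> \<theta>"
abbreviation "cf \<equiv> fund_alcove \<Delta> \<theta>"

lemma root_nonzero: "\<alpha> \<in> \<Phi> \<Longrightarrow> \<alpha> \<noteq> 0"
  and finite_roots: "finite \<Phi>"
  using roots unfolding root_system_def by auto

lemma simple_subset: "\<Delta> \<subseteq> \<Phi>" and theta_root: "\<theta> \<in> \<Phi>"
  using simple highest unfolding simple_roots_def highest_root_def by auto

lemma hyperplanesE:
  assumes "K \<in> hyperplanes \<Phi>"
  obtains \<alpha> k where "\<alpha> \<in> \<Phi>" "\<alpha> \<noteq> 0" "K = hyperplane \<alpha> k"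
  using assms root_nonzero unfolding hyperplanes_def by blast

lemma hyperplanes_closed: "K \<in> hyperplanes \<Phi> \<Longrightarrow> convex K \<and> closed K \<and> affine K \<and> K \<noteq> {}"
proof (erule hyperplanesE)
  fix \<alpha> :: 'a and k
  assume *: "\<alpha> \<noteq> 0" "K = hyperplane \<alpha> k"
  then have "(of_int k / (\<alpha> \<bullet> \<alpha>)) *\<^sub>R \<alpha> \<in> K" by (simp add: hyperplane_def)
  with * show ?thesis
    unfolding hyperplane_def
    using convex_hyperplane closed_hyperplane affine_hyperplane by blast
qed

text \<open>With \<open>\<beta>'\<close> the reflected root and \<open>c\<close> the Cartan integer,
  the image is the hyperplane of \<open>\<beta>'\<close> at level \<open>m - k * c\<close>. The
  crystallographic condition makes this level an integer.\<close>

lemma hyperplane_reflect: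
  assumes "\<alpha> \<in> \<Phi>" "K \<in> hyperplanes \<Phi>"
  shows "refl_in (hyperplane \<alpha> k) ` K \<in> hyperplanes \<Phi>"
proof -
  obtain \<beta> m where \<beta>: "\<beta> \<in> \<Phi>" "K = hyperplane \<beta> m"
    using assms(2) by (blast elim: hyperplanesE)
  note nz = root_nonzero[OF assms(1)]
  obtain c where c: "2 * (\<alpha> \<bullet> \<beta>) / (\<alpha> \<bullet> \<alpha>) = of_int c"
    using crys assms(1) \<beta>(1) unfolding crystallographic_def Ints_def by blast
  define \<beta>' where "\<beta>' = refl_in (hyperplane \<alpha> 0) \<beta>"
  have "\<beta>' \<in> \<Phi>" using roots assms(1) \<beta>(1) unfolding root_system_def \<beta>'_def by blast
  have \<beta>': "\<beta>' = \<beta> - of_int c *\<^sub>R \<alpha>"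
    unfolding \<beta>'_def refl_in_hyperplane[OF nz] using c by simp
  have c': "2 * (\<alpha> \<bullet> \<beta>) = of_int c * (\<alpha> \<bullet> \<alpha>)"
    using c nz by (simp add: field_simps)
  have "\<beta>' \<bullet> refl_in (hyperplane \<alpha> k) v - of_int (m - k * c) = \<beta> \<bullet> v - of_int m" for v
  proof -
    define x where "x = 2 * (\<alpha> \<bullet> v - of_int k) / (\<alpha> \<bullet> \<alpha>)"
    have x: "x * (\<alpha> \<bullet> \<alpha>) = 2 * (\<alpha> \<bullet> v - of_int k)" using nz by (simp add: x_def)
    have "\<beta>' \<bullet> refl_in (hyperplane \<alpha> k) v = \<beta>' \<bullet> v - x * (\<beta>' \<bullet> \<alpha>)"
      unfolding refl_in_hyperplane[OF nz] x_def by (simp add: inner_diff_right)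
    also have "\<beta>' \<bullet> \<alpha> = - (\<alpha> \<bullet> \<beta>)"
      unfolding \<beta>' inner_diff_left using c' by (simp add: inner_commute[of \<beta> \<alpha>])
    also have "\<beta>' \<bullet> v - x * - (\<alpha> \<bullet> \<beta>) = \<beta> \<bullet> v - of_int c * (\<alpha> \<bullet> v) + x * (\<alpha> \<bullet> \<beta>)"
      unfolding \<beta>' by (simp add: inner_diff_left)
    also have "x * (\<alpha> \<bullet> \<beta>) = of_int c * (x * (\<alpha> \<bullet> \<alpha>)) / 2"
      using c' by algebra
    finally show ?thesis unfolding x by (simp add: field_simps)
  qed
  from motion_hyperplane_image[OF motion_refl_in[OF nz] this]
  have "refl_in (hyperplane \<alpha> k) ` K = hyperplane \<beta>' (m - k * c)"
    unfolding \<beta>(2) hyperplane_def by simp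
  then show ?thesis using \<open>\<beta>' \<in> \<Phi>\<close> unfolding hyperplanes_def by blast
qed

section \<open>The affine Weyl group and its action on hyperplanes\<close>

lemma simple_reflE:
  assumes "s \<in> S"
  obtains \<alpha> k where "\<alpha> \<in> \<Phi>" "s = refl_in (hyperplane \<alpha> k)"
  using assms simple_subset theta_root unfolding simple_refls_def by blast

lemma simple_refl_involution: "s \<in> S \<Longrightarrow> s \<circ> s = id"
  by (erule simple_reflE) (use root_nonzero in \<open>auto simp: refl_in_involution\<close>)

lemma W_id: "id \<in> W"
  unfolding affine_weyl_group_def by (rule image_eqI[of _ _ "[]"]) auto

lemma W_Cons: "s \<in> S \<Longrightarrow> w \<in> W \<Longrightarrow> s \<circ> w \<in> W"
proof -
  assume "s \<in> S" "w \<in> W"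
  then obtain ws where "ws \<in> lists S" "w = word_prod ws" unfolding affine_weyl_group_def by blast
  then show "s \<circ> w \<in> W"
    using \<open>s \<in> S\<close> unfolding affine_weyl_group_def by (intro image_eqI[of _ _ "s # ws"]) auto
qed

lemma S_subset_W: "s \<in> S \<Longrightarrow> s \<in> W"
  using W_Cons[OF _ W_id] by simp

lemma W_induct [consumes 1, case_names id Cons]:
  assumes "w \<in> W" "P id" "\<And>s w. s \<in> S \<Longrightarrow> w \<in> W \<Longrightarrow> P w \<Longrightarrow> P (s \<circ> w)"
  shows "P w"
proof -
  obtain ws where ws: "ws \<in> lists S" "w = word_prod ws"
    using assms(1) unfolding affine_weyl_group_def by blast
  from ws(1) have "P (word_prod ws)"
  proof (induction ws)
    case (Cons s ws)
    then have "word_prod ws \<in> W" unfolding affine_weyl_group_def by blast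
    with Cons have "P (s \<circ> word_prod ws)" by (intro assms(3)) simp_all
    then show ?case by (simp only: word_prod_Cons)
  qed (simp only: word_prod_Nil assms(2))
  then show ?thesis using ws(2) by simp
qed

lemma W_comp: "w \<in> W \<Longrightarrow> w' \<in> W \<Longrightarrow> w \<circ> w' \<in> W"
  by (induction rule: W_induct) (auto simp: comp_assoc W_Cons)

lemma W_inverse:
  assumes "w \<in> W"
  obtains w' where "w' \<in> W" "w \<circ> w' = id" "w' \<circ> w = id"
proof -
  from assms have "\<exists>w'\<in>W. w \<circ> w' = id \<and> w' \<circ> w = id"
  proof (induction rule: W_induct)
    case id
    show ?case by (rule bexI[OF _ W_id]) simp
  next
    case (Cons s w)
    then obtain w' where w': "w' \<in> W" "w \<circ> w' = id" "w' \<circ> w = id" by blast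
    have "w' \<circ> s \<in> W" using W_comp w' S_subset_W Cons by blast
    moreover have "(s \<circ> w) \<circ> (w' \<circ> s) = id" "(w' \<circ> s) \<circ> (s \<circ> w) = id"
      using w' simple_refl_involution[OF Cons(1)]
      by (metis comp_assoc comp_id)+
    ultimately show ?case by blast
  qed
  then show ?thesis using that by blast
qed

lemma W_motion: "w \<in> W \<Longrightarrow> motion w"
proof (induction rule: W_induct)
  case (Cons s w)
  then show ?case using motion_comp motion_refl_in root_nonzero by (metis simple_reflE)
qed (rule motion_id)

lemma W_hyperplanes: "w \<in> W \<Longrightarrow> K \<in> hyperplanes \<Phi> \<Longrightarrow> w ` K \<in> hyperplanes \<Phi>"
proof (induction arbitrary: K rule: W_induct)
  case (Cons s w)
  then have "w ` K \<in> hyperplanes \<Phi>" by simp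
  then show ?case
    using Cons(1) hyperplane_reflect by (metis image_comp simple_reflE)
qed simp

lemma W_refl_conj:
  "w \<in> W \<Longrightarrow> K \<in> hyperplanes \<Phi> \<Longrightarrow> refl_in (w ` K) \<circ> w = w \<circ> refl_in K"
  using motion_refl_in_conj[OF W_motion, of w K] hyperplanes_closed[of K]
    hyperplanes_closed[of "w ` K"] W_hyperplanes[of w K]
  by (simp add: fun_eq_iff)

text \<open>The infinite union is regrouped by root: for a fixed root the hyperplanes of all levels
  form the preimage of the integers, which is closed, and there are finitely many roots.\<close>

lemma closed_arrangement: "closed (\<Union> (hyperplanes \<Phi>))"
proof -
  have "\<Union> (hyperplanes \<Phi>) = (\<Union>\<alpha>\<in>\<Phi>. (\<lambda>v. \<alpha> \<bullet> v) -` \<int>)"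
    unfolding hyperplanes_def hyperplane_def Ints_def by blast
  moreover have "closed ((\<lambda>v. \<alpha> \<bullet> v) -` \<int>)" for \<alpha> :: 'a
    using closed_Ints by (intro closed_vimage) (auto intro: continuous_intros)
  ultimately show ?thesis using finite_roots by auto
qed

lemma component_one_side:
  assumes "X \<in> components (- \<Union> (hyperplanes \<Phi>))" "\<alpha> \<in> \<Phi>"
  shows "(\<forall>v\<in>X. \<alpha> \<bullet> v < of_int k) \<or> (\<forall>v\<in>X. of_int k < \<alpha> \<bullet> v)"
proof -
  have "\<alpha> \<bullet> v \<noteq> of_int k" if "v \<in> X" for v
    using that in_components_subset[OF assms(1)] assms(2)
    unfolding hyperplanes_def hyperplane_def by blast
  then show ?thesis
    using connected_ivt_hyperplane[OF in_components_connected[OF assms(1)], of _ _ \<alpha> "of_int k"]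
    by (metis linorder_neqE_linordered_idom order_less_imp_le)
qed

text \<open>\<open>Q\<close> is the intersection of all open half-spaces of the arrangement that
  contain \<open>x\<close>. It is convex, hence connected, contains \<open>X\<close> and avoids
  every hyperplane, so maximality of the component gives \<open>Q = X\<close>.\<close>

lemma component_convex:
  assumes X: "X \<in> components (- \<Union> (hyperplanes \<Phi>))"
  shows "convex X"
proof -
  obtain x where "x \<in> X" using in_components_nonempty[OF X] by blast
  define Q where "Q = (\<Inter>\<alpha>\<in>\<Phi>. \<Inter>k\<in>{k::int. \<alpha> \<bullet> x < of_int k}. {v. \<alpha> \<bullet> v < of_int k}) \<inter>
    (\<Inter>\<alpha>\<in>\<Phi>. \<Inter>k\<in>{k::int. \<alpha> \<bullet> x > of_int k}. {v. \<alpha> \<bullet> v > of_int k})"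
  have "convex Q"
    unfolding Q_def
    by (intro convex_Int convex_INT convex_halfspace_lt convex_halfspace_gt)
  moreover have "X \<subseteq> Q"
  proof
    fix v assume "v \<in> X"
    then show "v \<in> Q" unfolding Q_def using component_one_side[OF X] \<open>x \<in> X\<close>
      by (auto dest: less_asym)
  qed
  moreover have "Q \<subseteq> - \<Union> (hyperplanes \<Phi>)"
  proof
    fix v assume "v \<in> Q"
    have "\<alpha> \<bullet> v \<noteq> of_int k" if "\<alpha> \<in> \<Phi>" for \<alpha> k
    proof (cases "\<alpha> \<bullet> x < of_int k")
      case True
      then show ?thesis using \<open>v \<in> Q\<close> that unfolding Q_def by fastforce
    next
      case False
      then have "\<alpha> \<bullet> x > of_int k" using component_one_side[OF X that, of k] \<open>x \<in> X\<close> by auto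
      then show ?thesis using \<open>v \<in> Q\<close> that unfolding Q_def by fastforce
    qed
    then show "v \<in> - \<Union> (hyperplanes \<Phi>)" unfolding hyperplanes_def hyperplane_def by blast
  qed
  ultimately have "Q = X"
    using X convex_connected[of Q] \<open>x \<in> X\<close> unfolding in_components_maximal
    by (metis empty_iff subsetD)
  then show ?thesis using \<open>convex Q\<close> by simp
qed

lemma alcoveE:
  assumes "C \<in> alcoves \<Phi>"
  obtains X where "X \<in> components (- \<Union> (hyperplanes \<Phi>))" "C = closure X" "open X" "X \<noteq> {}"
    "convex X"
proof -
  from assms obtain X where X: "X \<in> components (- \<Union> (hyperplanes \<Phi>))" "C = closure X"
    unfolding alcoves_def by blast
  show ?thesis
    using that X component_convex[OF X(1)] in_components_nonempty[OF X(1)]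
      open_components[OF open_Compl[OF closed_arrangement] X(1)] by blast
qed

lemma alcove_convex: "C \<in> alcoves \<Phi> \<Longrightarrow> convex C"
  by (erule alcoveE) (simp add: convex_closure)

lemma alcove_interior: "C \<in> alcoves \<Phi> \<Longrightarrow> interior C \<noteq> {}"
  by (erule alcoveE) (metis closure_subset interior_maximal subset_empty)

lemma alcove_uncut:
  assumes C: "C \<in> alcoves \<Phi>" and K: "K \<in> hyperplanes \<Phi>"
  shows "uncut K C"
proof -
  obtain \<alpha> k where \<alpha>: "\<alpha> \<in> \<Phi>" "\<alpha> \<noteq> 0" "K = hyperplane \<alpha> k" using K hyperplanesE by blast
  obtain X where X: "X \<in> components (- \<Union> (hyperplanes \<Phi>))" "C = closure X"
    using C alcoveE by blast
  have "X \<subseteq> {v. \<alpha> \<bullet> v \<le> of_int k} \<or> X \<subseteq> {v. \<alpha> \<bullet> v \<ge> of_int k}"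
    using component_one_side[OF X(1) \<alpha>(1), of k] by fastforce
  then have "C \<subseteq> {v. \<alpha> \<bullet> v \<le> of_int k} \<or> C \<subseteq> {v. \<alpha> \<bullet> v \<ge> of_int k}"
    unfolding X(2) by (metis closure_minimal closed_halfspace_le closed_halfspace_ge)
  then show ?thesis
    unfolding \<alpha>(3) hyperplane_def using alcove_interior[OF C] \<alpha>(2) by (intro uncutI) auto
qed

lemma W_alcoves:
  assumes w: "w \<in> W" and C: "C \<in> alcoves \<Phi>"
  shows "w ` C \<in> alcoves \<Phi>"
proof -
  obtain w' where w': "w' \<in> W" "w \<circ> w' = id" "w' \<circ> w = id" using W_inverse[OF w] by blast
  have inv: "w (w' v) = v" "w' (w v) = v" for v using w'(2,3) by (auto simp: fun_eq_iff)
  \<comment> \<open>A hyperplane through \<open>u v\<close> would be carried by \<open>u'\<close> to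
    one through \<open>v\<close>. The general form serves both \<open>w\<close> and its
    inverse.\<close>
  have sub: "u ` (- \<Union> (hyperplanes \<Phi>)) \<subseteq> - \<Union> (hyperplanes \<Phi>)"
    if "u' \<in> W" and "\<And>v. u' (u v) = v" for u u'
  proof (clarsimp, rule ccontr)
    fix v K assume *: "\<forall>K\<in>hyperplanes \<Phi>. v \<notin> K" "u v \<in> K" "K \<in> hyperplanes \<Phi>"
    then have "v \<in> u' ` K" using that(2)[of v] by (metis imageI)
    then show False using * W_hyperplanes[OF that(1), of K] by blast
  qed
  obtain X where X: "X \<in> components (- \<Union> (hyperplanes \<Phi>))" "C = closure X"
    using C alcoveE by blast
  have "w ` X \<in> components (- \<Union> (hyperplanes \<Phi>))"
    using components_image[OF X(1) sub[OF w'(1)] sub[OF w]] inv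
      motion_continuous W_motion w w'(1) by blast
  then show ?thesis unfolding alcoves_def X(2) using motion_closure[OF W_motion[OF w]] by auto
qed

lemma W_simplices:
  assumes w: "w \<in> W" and F: "F \<in> simplices \<Phi>"
  shows "w ` F \<in> simplices \<Phi>"
proof -
  obtain C where "F \<noteq> {}" "C \<in> alcoves \<Phi>" "F face_of C" using F unfolding simplices_def by blast
  then have "w ` F \<noteq> {}" "w ` C \<in> alcoves \<Phi>" "w ` F face_of w ` C"
    using W_alcoves[OF w] motion_face_of[OF W_motion[OF w]] by auto
  then show ?thesis unfolding simplices_def by blast
qed

lemma W_simplex_type:
  assumes w: "w \<in> W"
  shows "simplex_type \<Delta> \<theta> (w ` F) = simplex_type \<Delta> \<theta> F"
proof -
  have sub: "simplex_type \<Delta> \<theta> F \<subseteq> simplex_type \<Delta> \<theta> (w ` F)" if "w \<in> W" for w F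
  proof
    fix s assume "s \<in> simplex_type \<Delta> \<theta> F"
    then obtain u G where *: "s \<in> S" "u \<in> W" "G face_of cf" "F = u ` G" "\<forall>v\<in>G. s v = v"
      unfolding simplex_type_def by blast
    moreover have "w ` F = (w \<circ> u) ` G" using *(4) by (simp add: image_comp)
    ultimately show "s \<in> simplex_type \<Delta> \<theta> (w ` F)"
      unfolding simplex_type_def using W_comp[OF that *(2)] by blast
  qed
  obtain w' where w': "w' \<in> W" "w' \<circ> w = id" using W_inverse[OF w] by blast
  have "w' ` w ` F = F" using w'(2) by (simp add: image_comp)
  then show ?thesis using sub[OF w, of F] sub[OF w'(1), of "w ` F"] by simp
qed

text \<open>A relative interior point \<open>q\<close> of the facet lies on some hyperplane, which
  supports the alcove and so cuts out a face; a face through \<open>q\<close> contains the whole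
  facet. This makes \<open>supporting_hyperplane\<close> well defined.\<close>

lemma facet_in_unique_hyperplane:
  assumes C: "C \<in> alcoves \<Phi>" and p: "p facet_of C"
  shows "\<exists>!K. K \<in> hyperplanes \<Phi> \<and> p \<subseteq> K"
proof (rule ex_ex1I)
  have face: "p face_of C" and "p \<noteq> {}" and dim: "aff_dim p = aff_dim C - 1"
    using p unfolding facet_of_def by auto
  have "convex p" using face_of_imp_convex face alcove_convex[OF C] by blast
  have "aff_dim C = int DIM('a)" by (rule aff_dim_nonempty_interior[OF alcove_interior[OF C]])
  obtain q where q: "q \<in> rel_interior p"
    using \<open>convex p\<close> \<open>p \<noteq> {}\<close> rel_interior_eq_empty by blast
  then have "q \<in> p" using rel_interior_subset by blast
  have disj: "p \<inter> interior C = {}" using face_of_disjoint_interior[OF face] dim by force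
  obtain X where X: "X \<in> components (- \<Union> (hyperplanes \<Phi>))" "C = closure X" "open X"
    using C alcoveE by blast
  \<comment> \<open>Off the arrangement, \<open>q\<close> would lie in an open component meeting
    \<open>X\<close>, hence in \<open>X\<close> itself and in the interior of \<open>C\<close>,
    which a proper face misses.\<close>
  have "q \<in> \<Union> (hyperplanes \<Phi>)"
  proof (rule ccontr)
    assume *: "q \<notin> \<Union> (hyperplanes \<Phi>)"
    then obtain Y where Y: "Y \<in> components (- \<Union> (hyperplanes \<Phi>))" "q \<in> Y"
      using Union_components[of "- \<Union> (hyperplanes \<Phi>)"] by blast
    have "open Y" using Y(1) open_components closed_arrangement by blast
    moreover have "q \<in> closure X" using \<open>q \<in> p\<close> face_of_imp_subset[OF face] X(2) by blast
    ultimately have "Y \<inter> X \<noteq> {}" using Y(2) open_Int_closure_eq_empty by blast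
    then have "Y = X" using components_nonoverlap X(1) Y(1) by blast
    then have "q \<in> interior C"
      using Y(2) X(2,3) interior_maximal[OF closure_subset] by blast
    then show False using disj \<open>q \<in> p\<close> by blast
  qed
  then obtain K where K: "K \<in> hyperplanes \<Phi>" "q \<in> K" by blast
  obtain a b where ab: "K = {v. a \<bullet> v = b}" "C \<subseteq> {v. a \<bullet> v \<le> b}"
    using alcove_uncut[OF C K(1)] unfolding uncut_def by blast
  have "C \<inter> {v. a \<bullet> v = b} face_of C"
    using ab(2) by (intro face_of_Int_supporting_hyperplane_le[OF alcove_convex[OF C]]) auto
  moreover have "q \<in> C \<inter> {v. a \<bullet> v = b}"
    using K(2) ab(1) face_of_imp_subset[OF face] \<open>q \<in> p\<close> by auto
  then have "(C \<inter> {v. a \<bullet> v = b}) \<inter> rel_interior p \<noteq> {}" using q by blast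
  ultimately have "p \<subseteq> C \<inter> {v. a \<bullet> v = b}"
    by (intro subset_of_face_of[OF _ face_of_imp_subset[OF face]])
  then show "\<exists>K. K \<in> hyperplanes \<Phi> \<and> p \<subseteq> K" using K(1) ab(1) by blast
  \<comment> \<open>The affine hull of a facet and a hyperplane both have codimension one, so
    containment is equality; this gives uniqueness.\<close>
  have hull: "affine hull p = K" if K: "K \<in> hyperplanes \<Phi>" "p \<subseteq> K" for K
  proof (rule affine_dim_equal)
    obtain \<alpha> k where "\<alpha> \<noteq> 0" "K = {v. \<alpha> \<bullet> v = of_int k}"
      using K(1) unfolding hyperplane_def[symmetric] by (blast elim: hyperplanesE)
    then show "aff_dim (affine hull p) = aff_dim K"
      using aff_dim_hyperplane[of \<alpha> "of_int k"] dim \<open>aff_dim C = _\<close> DIM_positive[where 'a='a]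
      by simp
    show "affine hull p \<subseteq> K" "affine K"
      using K hyperplanes_closed hull_minimal[of p K affine] by auto
  qed (use \<open>p \<noteq> {}\<close> in auto)
  show "K = K'" if "K \<in> hyperplanes \<Phi> \<and> p \<subseteq> K" "K' \<in> hyperplanes \<Phi> \<and> p \<subseteq> K'" for K K'
    using hull that by metis
qed

lemma supporting_hyperplaneI:
  assumes "C \<in> alcoves \<Phi>" "p facet_of C" "K \<in> hyperplanes \<Phi>" "p \<subseteq> K"
  shows "supporting_hyperplane \<Phi> p = K"
  unfolding supporting_hyperplane_def
  using the1_equality[OF facet_in_unique_hyperplane[OF assms(1,2)]] assms(3,4) by blast

lemma supporting_hyperplane:
  assumes "C \<in> alcoves \<Phi>" "p facet_of C"
  shows "supporting_hyperplane \<Phi> p \<in> hyperplanes \<Phi>" "p \<subseteq> supporting_hyperplane \<Phi> p"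
  using theI'[OF facet_in_unique_hyperplane[OF assms]] unfolding supporting_hyperplane_def by auto

lemma W_supporting_hyperplane:
  assumes "w \<in> W" "C \<in> alcoves \<Phi>" "p facet_of C"
  shows "supporting_hyperplane \<Phi> (w ` p) = w ` supporting_hyperplane \<Phi> p"
  using supporting_hyperplane[OF assms(2,3)] W_hyperplanes[OF assms(1)]
    motion_facet_of[OF W_motion[OF assms(1)]] assms
  by (intro supporting_hyperplaneI[OF W_alcoves[OF assms(1,2)]]) auto

end

section \<open>The fundamental alcove and the exchange property\<close>

text \<open>The prescribed values extend to a linear functional, and its adjoint at 1 is the vector
  representing it. Applied to the simple roots this yields, after scaling, points in the interior
  and on the walls of the fundamental alcove.\<close>

lemma independent_dual_vector:
  fixes B :: "'a::euclidean_space set"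
  assumes "independent B"
  obtains p where "\<And>b. b \<in> B \<Longrightarrow> b \<bullet> p = f b"
proof -
  obtain h :: "'a \<Rightarrow> real" where h: "linear h" "\<And>b. b \<in> B \<Longrightarrow> h b = f b"
    using linear_independent_extend[OF assms, of f] by blast
  have "b \<bullet> adjoint h 1 = h b" for b
    using adjoint_works[OF h(1), of b 1] by simp
  then show ?thesis using that h(2) by metis
qed

context affine_roots
begin

text \<open>The intended instance is \<open>y cf\<close> and \<open>y s cf\<close> with their common
  wall. Being cut by no hyperplane takes the place of membership in \<open>alcoves\<close>;
  \<open>fund_alcove_uncut\<close> provides it for \<open>cf\<close>, and \<open>W\<close> preserves
  it.\<close>

definition adjacent :: "'a set \<Rightarrow> 'a set \<Rightarrow> 'a set \<Rightarrow> bool" where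
  "adjacent H E E' \<longleftrightarrow> H \<in> hyperplanes \<Phi> \<and> (\<forall>K\<in>hyperplanes \<Phi>. uncut K E \<and> uncut K E') \<and>
     refl_in H \<in> W \<and> refl_in H ` E = E' \<and> separates H E E' \<and>
     (\<forall>K\<in>hyperplanes \<Phi>. separates K E E' \<longrightarrow> K = H)"

lemma simple_independent: "independent \<Delta>" and finite_simple: "finite \<Delta>"
  using simple independent_imp_finite unfolding simple_roots_def by auto

lemma nat_combs_nonneg:
  assumes "\<beta> \<in> nat_combs \<Delta>" "\<And>\<alpha>. \<alpha> \<in> \<Delta> \<Longrightarrow> 0 \<le> \<alpha> \<bullet> v"
  shows "0 \<le> \<beta> \<bullet> v"
  using assms unfolding nat_combs_def by (auto simp: inner_sum_left intro!: sum_nonneg)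

text \<open>The difference \<open>\<theta> - \<beta>\<close> is a natural combination of simple
  roots, hence nonnegative on the dominant chamber.\<close>

lemma root_le_highest:
  assumes "\<beta> \<in> \<Phi>" "\<And>\<alpha>. \<alpha> \<in> \<Delta> \<Longrightarrow> 0 \<le> \<alpha> \<bullet> v"
  shows "\<beta> \<bullet> v \<le> \<theta> \<bullet> v"
  using nat_combs_nonneg[of "\<theta> - \<beta>" v] highest assms
  unfolding highest_root_def by (auto simp: inner_diff_left)

lemma simple_nonempty: "\<Delta> \<noteq> {}"
proof
  assume "\<Delta> = {}"
  then have "\<theta> = 0" using simple theta_root unfolding simple_roots_def nat_combs_def by auto
  then show False using theta_root root_nonzero by blast
qed

lemma fund_alcove_interior: "interior cf \<noteq> {}"
proof -
  obtain p where p: "\<And>\<alpha>. \<alpha> \<in> \<Delta> \<Longrightarrow> \<alpha> \<bullet> p = 1"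
    using independent_dual_vector[OF simple_independent, of "\<lambda>_. 1"] by blast
  have "0 \<le> \<theta> \<bullet> p"
    using root_le_highest[of _ p] p simple_nonempty simple_subset by fastforce
  define O' where "O' = (\<Inter>\<alpha>\<in>\<Delta>. {v. \<alpha> \<bullet> v > 0}) \<inter> {v. \<theta> \<bullet> v < 1}"
  have "open O'"
    unfolding O'_def using finite_simple
    by (intro open_Int open_INT ballI open_halfspace_gt open_halfspace_lt)
  moreover have "O' \<subseteq> cf" unfolding O'_def fund_alcove_def by (auto intro: less_imp_le)
  \<comment> \<open>The denominator is positive and exceeds \<open>\<theta> \<bullet> p\<close>, so
    the scaled point keeps positive values at the simple roots and has a value below 1 at
    \<open>\<theta>\<close>.\<close>
  moreover have "(1 / (\<theta> \<bullet> p + 1)) *\<^sub>R p \<in> O'"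
    unfolding O'_def using p \<open>0 \<le> \<theta> \<bullet> p\<close> by auto
  ultimately show ?thesis using interior_maximal by blast
qed

text \<open>On \<open>cf\<close> a positive root takes values between 0 and 1, and no integer lies
  strictly between these. A negative root is handled through its opposite, at level
  \<open>- k\<close>.\<close>

lemma fund_alcove_uncut:
  assumes "K \<in> hyperplanes \<Phi>"
  shows "uncut K cf"
proof -
  obtain \<beta> k where \<beta>: "\<beta> \<in> \<Phi>" "\<beta> \<noteq> 0" "K = hyperplane \<beta> k" using assms by (rule hyperplanesE)
  have neg: "- \<gamma> \<in> \<Phi>" if "\<gamma> \<in> \<Phi>" for \<gamma>
    using roots that unfolding root_system_def by blast
  have strip: "(\<forall>v\<in>cf. \<gamma> \<bullet> v \<le> of_int m) \<or> (\<forall>v\<in>cf. of_int m \<le> \<gamma> \<bullet> v)"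
    if "\<gamma> \<in> \<Phi>" "\<gamma> \<in> nat_combs \<Delta>" for \<gamma> m
  proof -
    have *: "0 \<le> \<gamma> \<bullet> v \<and> \<gamma> \<bullet> v \<le> 1" if "v \<in> cf" for v
      using nat_combs_nonneg[OF \<open>\<gamma> \<in> nat_combs \<Delta>\<close>, of v] root_le_highest[OF \<open>\<gamma> \<in> \<Phi>\<close>, of v] that
      unfolding fund_alcove_def by auto
    show ?thesis
    proof (cases "m \<le> 0")
      case True
      then have "(of_int m :: real) \<le> 0" by simp
      then show ?thesis using * by (meson order_trans)
    next
      case False
      then have "1 \<le> (of_int m :: real)" by simp
      then show ?thesis using * by (meson order_trans)
    qed
  qed
  have "(\<forall>v\<in>cf. \<beta> \<bullet> v \<le> of_int k) \<or> (\<forall>v\<in>cf. of_int k \<le> \<beta> \<bullet> v)"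
  proof (cases "\<beta> \<in> nat_combs \<Delta>")
    case True
    then show ?thesis using strip \<beta>(1) by blast
  next
    case False
    then have "- \<beta> \<in> nat_combs \<Delta>" using simple \<beta>(1) unfolding simple_roots_def by blast
    then show ?thesis using strip[OF neg[OF \<beta>(1)], of "- k"] by auto
  qed
  then show ?thesis
    unfolding \<beta>(3) hyperplane_def by (intro uncutI \<beta>(2) fund_alcove_interior)
qed

section \<open>Adjacent translates of the fundamental alcove\<close>

lemma W_uncut:
  assumes w: "w \<in> W" and K: "K \<in> hyperplanes \<Phi>"
    and E: "\<And>K. K \<in> hyperplanes \<Phi> \<Longrightarrow> uncut K E"
  shows "uncut K (w ` E)"
proof -
  obtain w' where w': "w' \<in> W" "w \<circ> w' = id" using W_inverse[OF w] by blast
  have "uncut (w ` w' ` K) (w ` E)"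
    using motion_uncut[OF W_motion[OF w]] E W_hyperplanes[OF w'(1) K] by blast
  moreover have "w ` w' ` K = K" using w'(2) by (simp add: image_comp)
  ultimately show ?thesis by simp
qed

lemma W_separates_iff:
  assumes w: "w \<in> W"
  shows "separates (w ` K) (w ` C) (w ` D) \<longleftrightarrow> separates K C D"
proof
  obtain w' where w': "w' \<in> W" "w' \<circ> w = id" using W_inverse[OF w] by blast
  assume "separates (w ` K) (w ` C) (w ` D)"
  then have "separates (w' ` w ` K) (w' ` w ` C) (w' ` w ` D)"
    using motion_separates[OF W_motion[OF w'(1)]] by blast
  then show "separates K C D" using w'(2) by (simp add: image_comp)
qed (rule motion_separates[OF W_motion[OF w]])

text \<open>The neighbourhood \<open>N\<close> of \<open>p\<close> records that \<open>cf\<close>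
  contains a relatively open piece of each wall. This later forces any hyperplane separating the
  alcoves across the wall to be the wall.\<close>

lemma fund_alcove_wall:
  assumes "s \<in> S"
  obtains \<alpha> k p N where "\<alpha> \<in> \<Phi>" "s = refl_in (hyperplane \<alpha> k)"
    "(\<forall>v\<in>cf. \<alpha> \<bullet> v \<le> of_int k) \<or> (\<forall>v\<in>cf. of_int k \<le> \<alpha> \<bullet> v)"
    "open N" "p \<in> N" "p \<in> hyperplane \<alpha> k" "N \<inter> hyperplane \<alpha> k \<subseteq> cf"
proof -
  consider (affine) "s = refl_in (hyperplane \<theta> 1)"
    | (linear) \<beta> where "\<beta> \<in> \<Delta>" "s = refl_in (hyperplane \<beta> 0)"
    using assms unfolding simple_refls_def by blast
  then show ?thesis
  proof cases
    case affine
    obtain p where p: "\<And>\<alpha>. \<alpha> \<in> \<Delta> \<Longrightarrow> \<alpha> \<bullet> p = 1"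
      using independent_dual_vector[OF simple_independent, of "\<lambda>_. 1"] by blast
    have pos: "0 < \<theta> \<bullet> p"
      using root_le_highest[of _ p] p simple_nonempty simple_subset by fastforce
    \<comment> \<open>\<open>N\<close> keeps the inequalities of the other walls, made strict;
      dividing by \<open>\<theta> \<bullet> p\<close> puts \<open>p\<close> on the affine
      wall.\<close>
    define N where "N = (\<Inter>\<alpha>\<in>\<Delta>. {v. \<alpha> \<bullet> v > 0})"
    show ?thesis
    proof (rule that[OF theta_root, of 1 N "(1 / (\<theta> \<bullet> p)) *\<^sub>R p"])
      show "open N"
        unfolding N_def using finite_simple by (intro open_INT ballI open_halfspace_gt)
    qed (use affine p pos in \<open>auto simp: N_def hyperplane_def fund_alcove_def intro: less_imp_le\<close>)
  next
    case linear
    \<comment> \<open>Only \<open>\<beta>\<close> vanishes at \<open>p\<close>, so after scaling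
      down \<open>p\<close> lies on this wall and strictly inside all the others.\<close>
    obtain p where p: "\<And>\<alpha>. \<alpha> \<in> \<Delta> \<Longrightarrow> \<alpha> \<bullet> p = (if \<alpha> = \<beta> then 0 else 1)"
      using independent_dual_vector[OF simple_independent, of "\<lambda>\<alpha>. if \<alpha> = \<beta> then 0 else 1"] by blast
    have nonneg: "0 \<le> \<theta> \<bullet> p"
      using root_le_highest[of \<beta> p] p linear(1) simple_subset by fastforce
    define N where "N = (\<Inter>\<alpha>\<in>\<Delta> - {\<beta>}. {v. \<alpha> \<bullet> v > 0}) \<inter> {v. \<theta> \<bullet> v < 1}"
    show ?thesis
    proof (rule that[of \<beta> 0 N "(1 / (\<theta> \<bullet> p + 1)) *\<^sub>R p"])
      show "open N"
        unfolding N_def using finite_simple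
        by (intro open_Int open_INT ballI open_halfspace_gt open_halfspace_lt) auto
      show "N \<inter> hyperplane \<beta> 0 \<subseteq> cf"
        unfolding N_def hyperplane_def fund_alcove_def by (auto intro: less_imp_le)
    qed (use linear p nonneg simple_subset in \<open>auto simp: N_def hyperplane_def fund_alcove_def\<close>)
  qed
qed

text \<open>Points of \<open>cf\<close> on the wall are fixed by \<open>s\<close>, so they belong to
  both alcoves and hence to every hyperplane separating them; an open piece of the wall determines
  the wall.\<close>

lemma adjacent_simple:
  assumes s: "s \<in> S"
  obtains H where "adjacent H cf (s ` cf)" "s = refl_in H"
proof -
  obtain \<alpha> k p N where w: "\<alpha> \<in> \<Phi>" "s = refl_in (hyperplane \<alpha> k)"
    "(\<forall>v\<in>cf. \<alpha> \<bullet> v \<le> of_int k) \<or> (\<forall>v\<in>cf. of_int k \<le> \<alpha> \<bullet> v)"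
    "open N" "p \<in> N" "p \<in> hyperplane \<alpha> k" "N \<inter> hyperplane \<alpha> k \<subseteq> cf"
    using fund_alcove_wall[OF s] by metis
  define H where "H = hyperplane \<alpha> k"
  note nz = root_nonzero[OF w(1)]
  have H: "H \<in> hyperplanes \<Phi>" using w(1) unfolding H_def hyperplanes_def by blast
  have "\<alpha> \<bullet> s v - of_int k = - (\<alpha> \<bullet> v - of_int k)" for v
    unfolding w(2) refl_in_hyperplane[OF nz] using nz by (simp add: inner_diff_right)
  then have "\<alpha> \<bullet> s v \<le> of_int k \<longleftrightarrow> of_int k \<le> \<alpha> \<bullet> v" "of_int k \<le> \<alpha> \<bullet> s v \<longleftrightarrow> \<alpha> \<bullet> v \<le> of_int k" for v
    by (smt (verit))+
  then have sep: "separates H cf (s ` cf)"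
    using w(3) unfolding H_def hyperplane_def separates_iff[OF nz] by auto
  have unique: "K = H" if K: "K \<in> hyperplanes \<Phi>" "separates K cf (s ` cf)" for K
  proof -
    obtain \<beta> m where \<beta>: "\<beta> \<in> \<Phi>" "\<beta> \<noteq> 0" "K = hyperplane \<beta> m" using K(1) by (rule hyperplanesE)
    have near: "N \<inter> H \<subseteq> K"
    proof
      fix v assume v: "v \<in> N \<inter> H"
      then have "s v = v" unfolding w(2) refl_in_fix_iff[OF nz] H_def by blast
      moreover have "v \<in> cf" using v w(7) H_def by blast
      ultimately have "v \<in> s ` cf" by (metis imageI)
      then show "v \<in> K" using separates_Int_subset[OF K(2)] \<open>v \<in> cf\<close> by blast
    qed
    have p: "p \<in> H" using w(6) H_def by simp
    obtain e where e: "e > 0" "ball p e \<subseteq> N" using w(4,5) open_contains_ball by blast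
    have "H \<subseteq> K"
    proof
      fix v assume v: "v \<in> H"
      \<comment> \<open>The point \<open>v\<close> is shrunk towards \<open>p\<close> until it
        enters the ball inside \<open>N\<close>; as \<open>K\<close> contains \<open>p\<close> and
        the shrunken point, it contains \<open>v\<close>. The summand 1 keeps \<open>q\<close>
        positive when \<open>v = p\<close>.\<close>
      define q where "q = norm (v - p) + 1"
      define r where "r = e / 2 / q"
      have q: "q > 0" "norm (v - p) \<le> q" by (simp_all add: q_def add_nonneg_pos)
      have r: "r > 0" using e(1) q(1) by (simp add: r_def)
      have "r * norm (v - p) \<le> r * q" using r q(2) by (intro mult_left_mono) auto
      also have "r * q = e / 2" using q(1) by (simp add: r_def)
      also have "\<dots> < e" using e(1) by simp
      finally have "p + r *\<^sub>R (v - p) \<in> N" using e(2) r by (auto simp: dist_norm)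
      moreover have "p + r *\<^sub>R (v - p) \<in> H"
        using p v unfolding H_def hyperplane_def by (simp add: inner_add_right inner_diff_right)
      ultimately have "p + r *\<^sub>R (v - p) \<in> K" using near by blast
      moreover have "p \<in> K" using near p w(5) by blast
      ultimately have "r * (\<beta> \<bullet> (v - p)) = 0"
        unfolding \<beta>(3) hyperplane_def by (simp add: inner_add_right)
      then show "v \<in> K"
        using r \<open>p \<in> K\<close> unfolding \<beta>(3) hyperplane_def by (simp add: inner_diff_right)
    qed
    then obtain c where c: "c \<noteq> 0" "\<beta> = c *\<^sub>R \<alpha>" "real_of_int m = c * real_of_int k"
      unfolding H_def \<beta>(3) hyperplane_def
      using hyperplane_subset_imp_scaled[OF nz \<beta>(2)] by blast
    then show ?thesis unfolding H_def \<beta>(3) hyperplane_def by auto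
  qed
  have "adjacent H cf (s ` cf)"
    unfolding adjacent_def
  proof (intro conjI ballI impI)
    show "refl_in H \<in> W" "refl_in H ` cf = s ` cf"
      using S_subset_W[OF s] unfolding H_def w(2)[symmetric] by simp_all
    fix K assume K: "K \<in> hyperplanes \<Phi>"
    show "uncut K cf" "uncut K (s ` cf)"
      by (rule fund_alcove_uncut[OF K], rule W_uncut[OF S_subset_W[OF s] K fund_alcove_uncut])
    show "K = H" if "separates K cf (s ` cf)" by (rule unique[OF K that])
  qed (rule H, rule sep)
  then show ?thesis using that w(2) H_def by blast
qed

text \<open>The reflection in the moved wall is the conjugate of the old one by \<open>w\<close>.
  Uniqueness is checked by moving a competing hyperplane back.\<close>

lemma adjacent_W:
  assumes adj: "adjacent H E E'" and w: "w \<in> W"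
  shows "adjacent (w ` H) (w ` E) (w ` E')"
proof -
  obtain w' where w': "w' \<in> W" "w \<circ> w' = id" "w' \<circ> w = id" using W_inverse[OF w] by blast
  have H: "H \<in> hyperplanes \<Phi>" and r: "refl_in H \<in> W" "refl_in H ` E = E'"
    and uncut: "\<And>K. K \<in> hyperplanes \<Phi> \<Longrightarrow> uncut K E" "\<And>K. K \<in> hyperplanes \<Phi> \<Longrightarrow> uncut K E'"
    and sep: "separates H E E'" and unique: "\<And>K. K \<in> hyperplanes \<Phi> \<Longrightarrow> separates K E E' \<Longrightarrow> K = H"
    using adj unfolding adjacent_def by auto
  note conj = W_refl_conj[OF w H]
  have "refl_in (w ` H) = refl_in (w ` H) \<circ> (w \<circ> w')" using w'(2) by simp
  also have "\<dots> = w \<circ> (refl_in H \<circ> w')" using conj by (metis comp_assoc)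
  finally have 1: "refl_in (w ` H) \<in> W" using W_comp w w'(1) r(1) by simp
  have 2: "refl_in (w ` H) ` w ` E = w ` E'" using conj r(2) by (metis image_comp)
  have 3: "K = w ` H" if "K \<in> hyperplanes \<Phi>" "separates K (w ` E) (w ` E')" for K
  proof -
    have K: "w ` w' ` K = K" using w'(2) by (simp add: image_comp)
    have "separates (w' ` K) E E'" using that(2) W_separates_iff[OF w, of "w' ` K"] K by simp
    then have "w' ` K = H" using unique W_hyperplanes[OF w'(1) that(1)] by blast
    then show ?thesis using K by simp
  qed
  show ?thesis
    unfolding adjacent_def
  proof (intro conjI ballI impI)
    fix K assume K: "K \<in> hyperplanes \<Phi>"
    show "uncut K (w ` E)" "uncut K (w ` E')" using W_uncut[OF w K] uncut by blast+
    show "K = w ` H" if "separates K (w ` E) (w ` E')" using 3[OF K that] .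
  qed (use 1 2 W_hyperplanes[OF w H] motion_separates[OF W_motion[OF w] sep] in auto)
qed

text \<open>The word is read as a walk from \<open>cf\<close> to the final alcove. If
  \<open>H\<close> is the first wall crossed, the first letter is deleted, as it cancels against the
  reflection; otherwise \<open>H\<close> is moved by \<open>s\<close> and the rest of the word is
  treated by induction.\<close>

lemma exchange:
  assumes "ws \<in> lists S" "H \<in> hyperplanes \<Phi>" "separates H cf (word_prod ws ` cf)"
  shows "\<exists>ws'\<in>lists S. length ws' < length ws \<and> word_prod ws' = refl_in H \<circ> word_prod ws"
  using assms
proof (induction arbitrary: H rule: lists.induct)
  case Nil
  then show ?case using not_separates_self fund_alcove_uncut by auto
next
  case (Cons s ws)
  note s = Cons.hyps(1) and ws = Cons.hyps(2)
  define w where "w = word_prod ws"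
  have w: "w \<in> W" using ws unfolding w_def affine_weyl_group_def by blast
  have ss: "s \<circ> s = id" by (rule simple_refl_involution[OF s])
  obtain H0 where H0: "adjacent H0 cf (s ` cf)" "s = refl_in H0" using adjacent_simple[OF s] by blast
  show ?case
  proof (cases "H = H0")
    case True
    then have "w = refl_in H \<circ> (s \<circ> w)" using H0(2) ss by (metis comp_assoc id_comp)
    then have "word_prod ws = refl_in H \<circ> word_prod (s # ws)" by (simp only: word_prod_Cons w_def)
    then show ?thesis using ws by (intro bexI[of _ ws] conjI) (simp, assumption+)
  next
    case False
    have img: "word_prod (s # ws) ` cf = s ` w ` cf" by (simp add: w_def image_comp)
    have u: "uncut H cf" "uncut H (s ` w ` cf)" "uncut H (s ` cf)"
      using fund_alcove_uncut W_uncut[OF w] W_uncut[OF S_subset_W[OF s]] Cons.prems(1) by auto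
    \<comment> \<open>Only \<open>H0\<close> lies between \<open>cf\<close> and its neighbour, so
      \<open>H\<close> separates the neighbour from the end; applying \<open>s\<close> gives the
      same situation for the shorter word.\<close>
    have "\<not> separates H cf (s ` cf)" using H0(1) False Cons.prems(1) unfolding adjacent_def by blast
    then have "separates H (s ` cf) (s ` w ` cf)"
      using Cons.prems(2) separates_uncut[OF u(1) u(3) u(2)] unfolding img by blast
    moreover have "s ` s ` H = H" using ss by (simp add: image_comp)
    ultimately have "separates (s ` H) cf (w ` cf)"
      using W_separates_iff[OF S_subset_W[OF s], of "s ` H" cf "w ` cf"] by simp
    then obtain ws' where ws': "ws' \<in> lists S" "length ws' < length ws"
      "word_prod ws' = refl_in (s ` H) \<circ> w"
      using Cons.IH[OF W_hyperplanes[OF S_subset_W[OF s] Cons.prems(1)]] unfolding w_def by blast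
    \<comment> \<open>Conjugation by \<open>s\<close> turns the reflection in the moved wall back
      into the one in \<open>H\<close>.\<close>
    have "s \<circ> (refl_in (s ` H) \<circ> w) = s \<circ> ((refl_in (s ` H) \<circ> s) \<circ> (s \<circ> w))"
      using ss by (metis comp_assoc id_comp)
    also have "\<dots> = refl_in H \<circ> (s \<circ> w)"
      unfolding W_refl_conj[OF S_subset_W[OF s] Cons.prems(1)] using ss by (metis comp_assoc id_comp)
    finally have "word_prod (s # ws') = refl_in H \<circ> word_prod (s # ws)"
      by (simp only: word_prod_Cons ws'(3) w_def)
    then show ?thesis using ws'(1,2) s by (intro bexI[of _ "s # ws'"] conjI) (simp, assumption, simp)
  qed
qed

lemma coxeter_length_le:
  "ws \<in> lists S \<Longrightarrow> coxeter_length \<Delta> \<theta> (word_prod ws) \<le> length ws"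
  unfolding coxeter_length_def by (rule Least_le) blast

lemma coxeter_length_word:
  assumes "w \<in> W"
  obtains ws where "ws \<in> lists S" "length ws = coxeter_length \<Delta> \<theta> w" "word_prod ws = w"
proof -
  have "\<exists>k. \<exists>ws\<in>lists S. length ws = k \<and> word_prod ws = w"
    using assms unfolding affine_weyl_group_def by blast
  from LeastI_ex[OF this] show ?thesis using that unfolding coxeter_length_def by blast
qed

text \<open>Otherwise the exchange property, applied to a reduced word of \<open>y\<close>, would
  write \<open>y \<circ> s\<close> with fewer letters than the length of \<open>y\<close>.\<close>

lemma ascent_not_separates:
  assumes y: "y \<in> W" and H: "H \<in> hyperplanes \<Phi>" and r: "refl_in H \<circ> y = y \<circ> s"
    and len: "coxeter_length \<Delta> \<theta> (y \<circ> s) > coxeter_length \<Delta> \<theta> y"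
  shows "\<not> separates H cf (y ` cf)"
proof
  obtain ws where ws: "ws \<in> lists S" "length ws = coxeter_length \<Delta> \<theta> y" "word_prod ws = y"
    using coxeter_length_word[OF y] by blast
  assume "separates H cf (y ` cf)"
  then obtain ws' where "ws' \<in> lists S" "length ws' < length ws" "word_prod ws' = y \<circ> s"
    using exchange[OF ws(1) H] ws(3) r by auto
  then show False using coxeter_length_le[of ws'] len ws(2) by simp
qed

end

section \<open>Refolding galleries\<close>

text \<open>
  Face \<open>i > 0\<close> moves with chamber \<open>i - 1\<close> and face \<open>0\<close> never moves, so the result is a gallery only if
  \<open>r\<close> fixes the faces at which \<open>e\<close> changes its value.
\<close>

definition refold :: "('a \<Rightarrow> 'a) \<Rightarrow> (nat \<Rightarrow> bool) \<Rightarrow> 'a gallery \<Rightarrow> 'a gallery" where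
  "refold r e \<delta> =
     (map (\<lambda>i. if i \<noteq> 0 \<and> e (i - 1) then r ` (faces \<delta> ! i) else faces \<delta> ! i) [0..<length (faces \<delta>)],
      map (\<lambda>i. if e i then r ` (chambers \<delta> ! i) else chambers \<delta> ! i) [0..<length (chambers \<delta>)])"

lemma length_refold [simp]:
  "length (faces (refold r e \<delta>)) = length (faces \<delta>)"
  "length (chambers (refold r e \<delta>)) = length (chambers \<delta>)"
  unfolding refold_def faces_def chambers_def by auto

lemma faces_refold:
  "i < length (faces \<delta>) \<Longrightarrow>
     faces (refold r e \<delta>) ! i = (if i \<noteq> 0 \<and> e (i - 1) then r ` (faces \<delta> ! i) else faces \<delta> ! i)"
  and chambers_refold:
  "i < length (chambers \<delta>) \<Longrightarrow>
     chambers (refold r e \<delta>) ! i = (if e i then r ` (chambers \<delta> ! i) else chambers \<delta> ! i)"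
  unfolding refold_def by (auto simp: faces_def chambers_def)

lemma gallery_nth:
  assumes "length (faces \<delta>) = length (chambers \<delta>) + 1"
  shows "first_face \<delta> = faces \<delta> ! 0" "last_face \<delta> = faces \<delta> ! length (chambers \<delta>)"
proof -
  have "faces \<delta> \<noteq> []" using assms by auto
  then show "first_face \<delta> = faces \<delta> ! 0" "last_face \<delta> = faces \<delta> ! length (chambers \<delta>)"
    using assms unfolding first_face_def last_face_def by (simp_all add: hd_conv_nth last_conv_nth)
qed

context affine_roots
begin

lemma is_gallery_alt:
  "is_gallery \<Phi> \<delta> \<longleftrightarrow> 0 < length (chambers \<delta>) \<and> length (faces \<delta>) = length (chambers \<delta>) + 1 \<and>
     (\<forall>i<length (chambers \<delta>). chambers \<delta> ! i \<in> alcoves \<Phi>) \<and>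
     faces \<delta> ! 0 \<in> simplices \<Phi> \<and> faces \<delta> ! 0 \<subseteq> chambers \<delta> ! 0 \<and>
     faces \<delta> ! length (chambers \<delta>) \<in> simplices \<Phi> \<and>
     faces \<delta> ! length (chambers \<delta>) \<subseteq> chambers \<delta> ! (length (chambers \<delta>) - 1) \<and>
     (\<forall>i. 1 \<le> i \<and> i < length (chambers \<delta>) \<longrightarrow>
        faces \<delta> ! i facet_of chambers \<delta> ! (i - 1) \<and> faces \<delta> ! i facet_of chambers \<delta> ! i)"
proof (cases "chambers \<delta> \<noteq> [] \<and> length (faces \<delta>) = length (chambers \<delta>) + 1")
  case True
  then have ne: "chambers \<delta> \<noteq> []" and len: "length (faces \<delta>) = length (chambers \<delta>) + 1" by auto
  have "set (chambers \<delta>) \<subseteq> alcoves \<Phi> \<longleftrightarrow> (\<forall>i<length (chambers \<delta>). chambers \<delta> ! i \<in> alcoves \<Phi>)"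
    using all_set_conv_all_nth[of "chambers \<delta>" "\<lambda>c. c \<in> alcoves \<Phi>"] by blast
  then show ?thesis
    unfolding is_gallery_def gallery_nth[OF len] hd_conv_nth[OF ne] last_conv_nth[OF ne]
    using ne len by (simp add: Ball_def)
next
  case False
  then show ?thesis unfolding is_gallery_def by (metis length_greater_0_conv)
qed

text \<open>Where \<open>e\<close> changes, the panel is fixed by \<open>r\<close> and so is a facet
  of the moved as well as of the unmoved chamber; elsewhere it moves with both chambers or with
  neither. Types survive because \<open>r\<close> lies in \<open>W\<close>.\<close>

lemma refold_gallery:
  assumes \<delta>: "is_gallery \<Phi> \<delta>" and r: "r \<in> W"
    and first: "e 0 \<Longrightarrow> r ` first_face \<delta> = first_face \<delta>"
    and compat: "\<And>i. 1 \<le> i \<Longrightarrow> i < length (chambers \<delta>) \<Longrightarrow> e (i - 1) \<noteq> e i \<Longrightarrow>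
      r ` (faces \<delta> ! i) = faces \<delta> ! i"
  shows "is_gallery \<Phi> (refold r e \<delta>)"
    and "gallery_type \<Delta> \<theta> (refold r e \<delta>) = gallery_type \<Delta> \<theta> \<delta>"
    and "first_face (refold r e \<delta>) = first_face \<delta>"
    and "last_face (refold r e \<delta>) =
      (if e (length (chambers \<delta>) - 1) then r ` last_face \<delta> else last_face \<delta>)"
proof -
  define n where "n = length (chambers \<delta>)"
  note g = \<delta>[unfolded is_gallery_alt, folded n_def]
  have n: "0 < n" and len: "length (faces \<delta>) = n + 1" using g by auto
  have len': "length (faces (refold r e \<delta>)) = length (chambers (refold r e \<delta>)) + 1"
    using len by (simp add: n_def)
  note nth = gallery_nth[OF len[unfolded n_def]] gallery_nth[OF len']
  note F = faces_refold[of _ \<delta> r e, unfolded len] and C = chambers_refold[of _ \<delta> r e, folded n_def]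
  show "first_face (refold r e \<delta>) = first_face \<delta>"
    unfolding nth using F[of 0] by simp
  show "last_face (refold r e \<delta>) =
      (if e (length (chambers \<delta>) - 1) then r ` last_face \<delta> else last_face \<delta>)"
    unfolding nth using F[of n] n by (simp add: n_def)
  show "gallery_type \<Delta> \<theta> (refold r e \<delta>) = gallery_type \<Delta> \<theta> \<delta>"
    unfolding gallery_type_def
    by (rule nth_equalityI) (auto simp: faces_refold W_simplex_type[OF r])
  have facet: "faces (refold r e \<delta>) ! i facet_of chambers (refold r e \<delta>) ! (i - 1) \<and>
      faces (refold r e \<delta>) ! i facet_of chambers (refold r e \<delta>) ! i" if i: "1 \<le> i" "i < n" for i
  proof -
    have f: "faces \<delta> ! i facet_of chambers \<delta> ! (i - 1)" "faces \<delta> ! i facet_of chambers \<delta> ! i"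
      using g i by auto
    have rf: "r ` (faces \<delta> ! i) facet_of r ` (chambers \<delta> ! (i - 1))"
      "r ` (faces \<delta> ! i) facet_of r ` (chambers \<delta> ! i)"
      using f motion_facet_of[OF W_motion[OF r]] by auto
    have eq: "faces (refold r e \<delta>) ! i = (if e (i - 1) then r ` (faces \<delta> ! i) else faces \<delta> ! i)"
      "chambers (refold r e \<delta>) ! i = (if e i then r ` (chambers \<delta> ! i) else chambers \<delta> ! i)"
      "chambers (refold r e \<delta>) ! (i - 1) =
        (if e (i - 1) then r ` (chambers \<delta> ! (i - 1)) else chambers \<delta> ! (i - 1))"
      using F[of i] C[of i] C[of "i - 1"] i by auto
    show ?thesis
      unfolding eq using f rf compat[of i] i n_def by (cases "e (i - 1)"; cases "e i") auto
  qed
  have "\<forall>i<n. chambers (refold r e \<delta>) ! i \<in> alcoves \<Phi>"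
    using C g W_alcoves[OF r] by simp
  moreover have "faces (refold r e \<delta>) ! 0 = faces \<delta> ! 0" using F[of 0] by simp
  moreover have "faces \<delta> ! 0 \<subseteq> chambers (refold r e \<delta>) ! 0"
  proof (cases "e 0")
    case True
    then have "r ` (faces \<delta> ! 0) = faces \<delta> ! 0" using first nth by simp
    moreover have "r ` (faces \<delta> ! 0) \<subseteq> r ` (chambers \<delta> ! 0)" using g by (intro image_mono) simp
    ultimately show ?thesis using C[OF n] True by simp
  qed (use C[OF n] g in simp)
  moreover have "faces (refold r e \<delta>) ! n \<in> simplices \<Phi> \<and>
      faces (refold r e \<delta>) ! n \<subseteq> chambers (refold r e \<delta>) ! (n - 1)"
    using F[of n] C[of "n - 1"] n g W_simplices[OF r] by (auto simp: image_mono)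
  ultimately show "is_gallery \<Phi> (refold r e \<delta>)"
    unfolding is_gallery_alt length_refold n_def[symmetric] using n len g facet by simp
qed

section \<open>The reflection in a wall and its two sides\<close>

lemma hyperplane_refl_fix:
  assumes "H \<in> hyperplanes \<Phi>" "p \<subseteq> H"
  shows "refl_in H ` p = p"
proof -
  obtain \<alpha> k where "\<alpha> \<noteq> 0" "H = hyperplane \<alpha> k" using assms(1) by (rule hyperplanesE)
  then have "refl_in H v = v" if "v \<in> p" for v using refl_in_fix_iff assms(2) that by blast
  then show ?thesis by simp
qed

lemma hyperplane_refl_refl:
  assumes "H \<in> hyperplanes \<Phi>"
  shows "refl_in H ` refl_in H ` A = A"
proof -
  obtain \<alpha> k where "\<alpha> \<noteq> 0" "H = hyperplane \<alpha> k" using assms by (rule hyperplanesE)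
  then show ?thesis by (simp add: image_image refl_in_involution)
qed

lemma adjacent_commute:
  assumes "adjacent H E E'"
  shows "adjacent H E' E"
proof -
  have "H \<in> hyperplanes \<Phi>" "refl_in H ` E = E'" using assms unfolding adjacent_def by auto
  then have "refl_in H ` E' = E" using hyperplane_refl_refl by blast
  then show ?thesis using assms unfolding adjacent_def separates_commute[of _ E'] by blast
qed

text \<open>As \<open>E\<close> and \<open>E'\<close> lie on opposite sides of \<open>H\<close>, a
  folding at \<open>H\<close> is positive for exactly one of them.\<close>

lemma adjacent_separates:
  assumes "adjacent H E E'" "uncut H X"
  shows "separates H X E' \<longleftrightarrow> \<not> separates H X E"
proof -
  have "uncut H E" "uncut H E'" "separates H E E'" using assms(1) unfolding adjacent_def by simp_all
  then show ?thesis using separates_uncut[OF assms(2)] by blast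
qed

lemma adjacent_refl_separates:
  assumes adj: "adjacent H E E'" and sep: "separates K X E"
  shows "separates (refl_in H ` K) (refl_in H ` X) E'"
proof -
  have "refl_in H \<in> W" "refl_in H ` E = E'" using adj unfolding adjacent_def by simp_all
  then show ?thesis using motion_separates[OF W_motion sep, of "refl_in H"] by simp
qed

definition folded_in :: "'a gallery \<Rightarrow> 'a set \<Rightarrow> nat \<Rightarrow> bool" where
  "folded_in \<delta> H i \<longleftrightarrow> folded_at \<delta> i \<and> faces \<delta> ! i \<subseteq> H"

text \<open>Panel \<open>i\<close> lies between chambers \<open>i - 1\<close> and \<open>i\<close>,
  so at a folding at \<open>a\<close> or \<open>b\<close> just one of two equal chambers is
  reflected, which gives a crossing. The interval reaches an end of the gallery if
  \<open>a = 0\<close> or if \<open>b\<close> is at least the number of chambers; it misses the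
  gallery if \<open>a\<close> equals that number.\<close>

lemma refold_positively_folded:
  fixes a b :: nat
  assumes adj: "adjacent H E E'" and \<delta>: "is_gallery \<Phi> \<delta>" and pos: "positively_folded \<Phi> E \<delta>"
    and "a < b"
    and a: "0 < a \<Longrightarrow> a < length (chambers \<delta>) \<Longrightarrow> folded_in \<delta> H a"
    and b: "b < length (chambers \<delta>) \<Longrightarrow> folded_in \<delta> H b"
    and folds: "\<And>i. folded_in \<delta> H i \<Longrightarrow> a \<le> i \<and> i \<le> b"
    and first: "a = 0 \<Longrightarrow> separates H (chambers \<delta> ! 0) E \<Longrightarrow> first_face \<delta> \<subseteq> H"
  defines "e \<equiv> \<lambda>i. a \<le> i \<and> i < b \<and> separates H (chambers \<delta> ! i) E"
  shows "\<exists>\<delta>'. is_gallery \<Phi> \<delta>' \<and> gallery_type \<Delta> \<theta> \<delta>' = gallery_type \<Delta> \<theta> \<delta> \<and>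
    first_face \<delta>' = first_face \<delta> \<and> positively_folded \<Phi> E' \<delta>' \<and>
    last_face \<delta>' =
      (if e (length (chambers \<delta>) - 1) then refl_in H ` last_face \<delta> else last_face \<delta>)"
proof -
  define n where "n = length (chambers \<delta>)"
  define r where "r = refl_in H"
  note g = \<delta>[unfolded is_gallery_alt, folded n_def]
  have H: "H \<in> hyperplanes \<Phi>" and r: "r \<in> W"
    and uncut: "\<And>K. K \<in> hyperplanes \<Phi> \<Longrightarrow> uncut K E" "\<And>K. K \<in> hyperplanes \<Phi> \<Longrightarrow> uncut K E'"
    and unique: "\<And>K. K \<in> hyperplanes \<Phi> \<Longrightarrow> separates K E E' \<Longrightarrow> K = H"
    using adj unfolding adjacent_def r_def by auto
  have alcove: "chambers \<delta> ! i \<in> alcoves \<Phi>" if "i < n" for i using g that by blast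
  have facet: "faces \<delta> ! i facet_of chambers \<delta> ! (i - 1)" "faces \<delta> ! i facet_of chambers \<delta> ! i"
    if "1 \<le> i" "i < n" for i using g that by auto
  have compat: "faces \<delta> ! i \<subseteq> H" if i: "1 \<le> i" "i < n" and ne: "e (i - 1) \<noteq> e i" for i
  proof -
    \<comment> \<open>\<open>e\<close> can change on entering the interval, on leaving it, or inside
      it at a change of side. The first two cases are covered by the assumed foldings at
      \<open>a\<close> and \<open>b\<close>.\<close>
    consider "i = a" | "i = b" | "a \<le> i - 1" "i < b"
      using ne i unfolding e_def by linarith
    then show ?thesis
    proof cases
      case 1
      then show ?thesis using a i unfolding folded_in_def n_def by auto
    next
      case 2
      then show ?thesis using b i unfolding folded_in_def n_def by auto
    next
      case 3
      then have "separates H (chambers \<delta> ! (i - 1)) E \<noteq> separates H (chambers \<delta> ! i) E"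
        using ne unfolding e_def by auto
      \<comment> \<open>Two chambers on different sides of \<open>H\<close> meet only inside
        \<open>H\<close>, and their common panel with them.\<close>
      then have "separates H (chambers \<delta> ! (i - 1)) (chambers \<delta> ! i)"
        using separates_uncut[OF alcove_uncut[OF alcove[of "i - 1"] H]
            alcove_uncut[OF alcove[OF i(2)] H] uncut(1)[OF H]] i by linarith
      moreover have "faces \<delta> ! i \<subseteq> chambers \<delta> ! (i - 1) \<inter> chambers \<delta> ! i"
        using facet[OF i] unfolding facet_of_def by (auto dest: face_of_imp_subset)
      ultimately show ?thesis using separates_Int_subset by blast
    qed
  qed
  have gal: "is_gallery \<Phi> (refold r e \<delta>)"
    "gallery_type \<Delta> \<theta> (refold r e \<delta>) = gallery_type \<Delta> \<theta> \<delta>"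
    "first_face (refold r e \<delta>) = first_face \<delta>"
    "last_face (refold r e \<delta>) =
      (if e (length (chambers \<delta>) - 1) then r ` last_face \<delta> else last_face \<delta>)"
    using refold_gallery[OF \<delta> r, of e] first compat hyperplane_refl_fix[OF H]
    unfolding r_def[symmetric] e_def n_def by auto
  \<comment> \<open>The reflection takes a selected chamber away from \<open>E'\<close>, since it
    exchanges \<open>E\<close> and \<open>E'\<close>; the other chambers of the interval were on the
    side of \<open>E\<close> from the start.\<close>
  have right_side: "\<not> separates H (chambers (refold r e \<delta>) ! i) E" if i: "a \<le> i" "i < b" "i < n" for i
  proof (cases "e i")
    case True
    then have "separates (r ` H) (r ` (chambers \<delta> ! i)) E'"
      using adjacent_refl_separates[OF adj] unfolding e_def r_def by blast
    then have "separates H (r ` (chambers \<delta> ! i)) E'"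
      using hyperplane_refl_fix[OF H order_refl] unfolding r_def by simp
    then show ?thesis
      using True i adjacent_separates[OF adj alcove_uncut[OF W_alcoves[OF r alcove] H], of i]
      by (simp add: chambers_refold n_def)
  next
    case False
    then show ?thesis using i by (simp add: chambers_refold n_def e_def)
  qed
  have "positively_folded \<Phi> E' (refold r e \<delta>)"
    unfolding positively_folded_def
  proof (intro allI impI)
    fix i
    assume fold: "folded_at (refold r e \<delta>) i"
    let ?c = "\<lambda>i. chambers (refold r e \<delta>) ! i" and ?p = "faces (refold r e \<delta>) ! i"
    have i: "1 \<le> i" "i < n" and same: "?c (i - 1) = ?c i"
      using fold unfolding folded_at_def n_def by auto
    have c: "?c j = (if e j then r ` (chambers \<delta> ! j) else chambers \<delta> ! j)" if "j < n" for j
      using that chambers_refold unfolding n_def by blast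
    have p: "?p = (if e (i - 1) then r ` (faces \<delta> ! i) else faces \<delta> ! i)"
      using faces_refold[of i \<delta> r e] i g by simp
    define K where "K = supporting_hyperplane \<Phi> (faces \<delta> ! i)"
    have K: "K \<in> hyperplanes \<Phi>" "faces \<delta> ! i \<subseteq> K"
      using supporting_hyperplane[OF alcove facet(2)] i unfolding K_def by auto
    have c': "?c i \<in> alcoves \<Phi>" using c[OF i(2)] alcove[OF i(2)] W_alcoves[OF r] by simp
    show "separates (supporting_hyperplane \<Phi> ?p) (?c i) E'"
    proof (cases "faces \<delta> ! i \<subseteq> H")
      case True
      then have "?p = faces \<delta> ! i" using p hyperplane_refl_fix[OF H] r_def by simp
      then have supp: "supporting_hyperplane \<Phi> ?p = H"
        using supporting_hyperplaneI[OF alcove facet(2) H True] i by simp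
      \<comment> \<open>A bad folding at \<open>H\<close> has both chamber positions outside the
        interval, so it was there before. Then \<open>folds\<close> leaves only
        \<open>i = b\<close>, but \<open>b - 1\<close> is in the interval because
        \<open>a < b\<close>.\<close>
      have "\<not> separates H (?c i) E"
      proof
        assume wrong: "separates H (?c i) E"
        then have out: "\<not> (a \<le> i \<and> i < b)" "\<not> (a \<le> i - 1 \<and> i - 1 < b)"
          using right_side[OF _ _ i(2)] right_side[OF _ _ less_imp_diff_less[OF i(2)], of 1] same
          by auto
        then have "\<not> e i" "\<not> e (i - 1)" unfolding e_def by auto
        then have "chambers \<delta> ! (i - 1) = chambers \<delta> ! i" using same c[of i] c[of "i - 1"] i by simp
        then have "folded_in \<delta> H i"
          using i True unfolding folded_in_def folded_at_def n_def by blast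
        then have "a \<le> i \<and> i \<le> b" by (rule folds)
        then show False using out i \<open>a < b\<close> by linarith
      qed
      then show ?thesis using supp adjacent_separates[OF adj alcove_uncut[OF c' H]] by simp
    next
      case False
      then have "K \<noteq> H" using K(2) by blast
      \<comment> \<open>Away from \<open>H\<close> both chambers at the panel are moved or both are
        not, and \<open>r\<close> is injective, so the folding was already present.\<close>
      have e: "e (i - 1) = e i" using compat[OF i] False by blast
      have "inj r" using bij_is_inj[OF motion_bij[OF W_motion[OF r]]] .
      then have "chambers \<delta> ! (i - 1) = chambers \<delta> ! i"
        using same c[of i] c[of "i - 1"] i e by (auto simp: inj_image_eq_iff split: if_splits)
      then have "folded_at \<delta> i" using i unfolding folded_at_def n_def by blast
      then have sep: "separates K (chambers \<delta> ! i) E"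
        using pos unfolding positively_folded_def K_def by blast
      show ?thesis
      proof (cases "e i")
        case True
        then have "supporting_hyperplane \<Phi> ?p = r ` K"
          using W_supporting_hyperplane[OF r alcove facet(2)] i e p unfolding K_def by simp
        then show ?thesis
          using adjacent_refl_separates[OF adj sep] True c[OF i(2)] unfolding r_def by simp
      next
        case False
        \<comment> \<open>\<open>K\<close> is not between \<open>E\<close> and \<open>E'\<close>, so
          an unmoved folding at \<open>K\<close> stays positive.\<close>
        have "\<not> separates K E E'" using unique[OF K(1)] \<open>K \<noteq> H\<close> by blast
        then have "separates K (chambers \<delta> ! i) E'"
          using sep separates_uncut[OF alcove_uncut[OF alcove[OF i(2)] K(1)] uncut(1)[OF K(1)]
              uncut(2)[OF K(1)]] by blast
        then show ?thesis using False e p c[OF i(2)] unfolding K_def by simp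
      qed
    qed
  qed
  then show ?thesis using gal unfolding r_def by blast
qed

section \<open>Comparison of the two shadows\<close>

lemma shadow_ascent:
  assumes y: "y \<in> W" and s: "s \<in> S"
    and len: "coxeter_length \<Delta> \<theta> (y \<circ> s) > coxeter_length \<Delta> \<theta> y"
    and first: "first_face \<gamma> \<subseteq> cf"
  defines "H \<equiv> separating_hyperplane \<Phi> ((y \<circ> s) ` cf) (y ` cf)"
  shows "shadow \<Phi> \<Delta> \<theta> \<gamma> (y \<circ> s) =
    shadow \<Phi> \<Delta> \<theta> \<gamma> y \<union>
    (\<lambda>F. refl_in H ` F) ` {F \<in> shadow \<Phi> \<Delta> \<theta> \<gamma> y. F \<subseteq> half_apartment H ((y \<circ> s) ` cf)}"
proof -
  define E where "E = y ` cf"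
  define E' where "E' = (y \<circ> s) ` cf"
  obtain H0 where H0: "adjacent H0 cf (s ` cf)" "s = refl_in H0" using adjacent_simple[OF s] .
  have adj: "adjacent (y ` H0) E E'"
    using adjacent_W[OF H0(1) y] unfolding E_def E'_def by (simp add: image_comp)
  have "H = y ` H0"
    unfolding H_def separating_hyperplane_def E_def[symmetric] E'_def[symmetric]
    using adj unfolding adjacent_def separates_commute[of _ E] by (intro the_equality) blast+
  with adj have adj: "adjacent H E E'" by simp
  note adj' = adjacent_commute[OF adj]
  have H: "H \<in> hyperplanes \<Phi>" and uncut: "uncut H E" "uncut H E'" and r: "refl_in H \<in> W"
    using adj unfolding adjacent_def by auto
  \<comment> \<open>\<open>s\<close> is the reflection in \<open>H0\<close>, and conjugation by
    \<open>y\<close> carries it to the reflection in \<open>H\<close>. This links the length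
    hypothesis to the position of \<open>cf\<close> relative to \<open>H\<close>.\<close>
  have "refl_in H \<circ> y = y \<circ> s"
    using W_refl_conj[OF y, of H0] H0 \<open>H = y ` H0\<close> unfolding adjacent_def by simp
  then have base: "\<not> separates H cf E"
    using ascent_not_separates[OF y H _ len] unfolding E_def by simp
  \<comment> \<open>The reference set \<open>D\<close> is a parameter so that refolding can be used
    from \<open>E\<close> to \<open>E'\<close> and back.\<close>
  define Gal where "Gal D \<delta> \<longleftrightarrow> is_gallery \<Phi> \<delta> \<and> gallery_type \<Delta> \<theta> \<delta> = gallery_type \<Delta> \<theta> \<gamma> \<and>
    first_face \<delta> = first_face \<gamma> \<and> positively_folded \<Phi> D \<delta>" for D \<delta>
  have sh: "shadow \<Phi> \<Delta> \<theta> \<gamma> y = {last_face \<delta> | \<delta>. Gal E \<delta>}"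
    "shadow \<Phi> \<Delta> \<theta> \<gamma> (y \<circ> s) = {last_face \<delta> | \<delta>. Gal E' \<delta>}"
    unfolding shadow_def Gal_def E_def E'_def by simp_all
  have gal: "0 < length (chambers \<delta>)" "chambers \<delta> ! 0 \<in> alcoves \<Phi>"
    "chambers \<delta> ! (length (chambers \<delta>) - 1) \<in> alcoves \<Phi>"
    "last_face \<delta> \<subseteq> chambers \<delta> ! (length (chambers \<delta>) - 1)" "first_face \<delta> \<subseteq> chambers \<delta> ! 0"
    if "Gal D \<delta>" for D \<delta>
  proof -
    have g: "is_gallery \<Phi> \<delta>" using that unfolding Gal_def by blast
    then have len: "length (faces \<delta>) = length (chambers \<delta>) + 1" unfolding is_gallery_def by blast
    show "0 < length (chambers \<delta>)" "chambers \<delta> ! 0 \<in> alcoves \<Phi>"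
      "chambers \<delta> ! (length (chambers \<delta>) - 1) \<in> alcoves \<Phi>"
      "last_face \<delta> \<subseteq> chambers \<delta> ! (length (chambers \<delta>) - 1)" "first_face \<delta> \<subseteq> chambers \<delta> ! 0"
      using g unfolding is_gallery_alt gallery_nth[OF len] by auto
  qed
  have fold_range: "1 \<le> i \<and> i < length (chambers \<delta>)" if "folded_in \<delta> H i" for \<delta> i
    using that unfolding folded_in_def folded_at_def by blast
  have refold: "\<exists>\<delta>'. Gal D' \<delta>' \<and> last_face \<delta>' =
      (if a \<le> length (chambers \<delta>) - 1 \<and> length (chambers \<delta>) - 1 < b \<and>
          separates H (chambers \<delta> ! (length (chambers \<delta>) - 1)) D
       then refl_in H ` last_face \<delta> else last_face \<delta>)"
    if "adjacent H D D'" "Gal D \<delta>" "a < b"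
      "0 < a \<Longrightarrow> a < length (chambers \<delta>) \<Longrightarrow> folded_in \<delta> H a"
      "b < length (chambers \<delta>) \<Longrightarrow> folded_in \<delta> H b"
      "\<And>i. folded_in \<delta> H i \<Longrightarrow> a \<le> i \<and> i \<le> b"
      "a = 0 \<Longrightarrow> separates H (chambers \<delta> ! 0) D \<Longrightarrow> first_face \<delta> \<subseteq> H"
    for D D' \<delta> a b
  proof -
    have \<delta>: "is_gallery \<Phi> \<delta>" "positively_folded \<Phi> D \<delta>"
      "gallery_type \<Delta> \<theta> \<delta> = gallery_type \<Delta> \<theta> \<gamma>" "first_face \<delta> = first_face \<gamma>"
      using that(2) unfolding Gal_def by simp_all
    show ?thesis
      using refold_positively_folded[OF that(1) \<delta>(1,2) that(3-7)] \<delta>(3,4)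
      unfolding Gal_def by simp
  qed
  \<comment> \<open>\<open>cf\<close> contains the first face and lies on the side of
    \<open>E\<close>, so a first chamber on the other side meets it only in \<open>H\<close>. This
    permits intervals starting at 0.\<close>
  have first_wall: "first_face \<delta> \<subseteq> H" if \<delta>: "Gal E \<delta>" and sep: "separates H (chambers \<delta> ! 0) E" for \<delta>
  proof -
    have "separates H (chambers \<delta> ! 0) cf"
      using separates_uncut[OF alcove_uncut[OF gal(2)[OF \<delta>] H] fund_alcove_uncut[OF H] uncut(1)]
        sep base by blast
    moreover have "first_face \<delta> \<subseteq> chambers \<delta> ! 0 \<inter> cf"
      using gal(5)[OF \<delta>] first \<delta> unfolding Gal_def by simp
    ultimately show ?thesis using separates_Int_subset by blast
  qed

  have keep: "\<exists>\<delta>'. Gal E' \<delta>' \<and> last_face \<delta>' = last_face \<delta>" if \<delta>: "Gal E \<delta>" for \<delta>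
  proof (cases "\<exists>i. folded_in \<delta> H i")
    case False
    let ?n = "length (chambers \<delta>)"
    \<comment> \<open>Without foldings at \<open>H\<close> the interval from \<open>?n\<close> to
      \<open>?n + 1\<close> lies beyond all chambers, so nothing is moved.\<close>
    have "\<not> ?n \<le> ?n - 1" using gal(1)[OF \<delta>] by linarith
    moreover have "\<exists>\<delta>'. Gal E' \<delta>' \<and> last_face \<delta>' =
        (if ?n \<le> ?n - 1 \<and> ?n - 1 < ?n + 1 \<and> separates H (chambers \<delta> ! (?n - 1)) E
         then refl_in H ` last_face \<delta> else last_face \<delta>)"
      by (rule refold[OF adj \<delta>]) (use False gal(1)[OF \<delta>] in auto)
    ultimately show ?thesis by simp
  next
    case True
    let ?n = "length (chambers \<delta>)" and ?I = "{i. folded_in \<delta> H i}"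
    have "?I \<subseteq> {..<?n}" using fold_range[of \<delta>] by auto
    then have fin: "finite ?I" by (rule finite_subset) simp
    have "Max ?I \<in> ?I" using Max_in[OF fin] True by blast
    then have m: "folded_in \<delta> H (Max ?I)" by simp
    have "i \<le> Max ?I" if "folded_in \<delta> H i" for i using Max_ge[OF fin] that by simp
    then have "\<exists>\<delta>'. Gal E' \<delta>' \<and> last_face \<delta>' =
        (if 0 \<le> ?n - 1 \<and> ?n - 1 < Max ?I \<and> separates H (chambers \<delta> ! (?n - 1)) E
         then refl_in H ` last_face \<delta> else last_face \<delta>)"
      using m fold_range[OF m] first_wall[OF \<delta>] by (intro refold[OF adj \<delta>]) simp_all
    \<comment> \<open>Foldings occur at positions below the number of chambers, so the last chamber
      is outside the interval and the last face stays.\<close>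
    moreover have "\<not> ?n - 1 < Max ?I" using fold_range[OF m] by linarith
    ultimately show ?thesis by simp
  qed
  have reflected: "\<exists>\<delta>'. Gal E' \<delta>' \<and> last_face \<delta>' = refl_in H ` last_face \<delta>"
    if \<delta>: "Gal E \<delta>" and half: "last_face \<delta> \<subseteq> half_apartment H E'" for \<delta>
  proof -
    let ?n = "length (chambers \<delta>)"
    let ?c = "chambers \<delta> ! (?n - 1)"
    have "\<exists>\<delta>'. Gal E' \<delta>' \<and> last_face \<delta>' =
        (if 0 \<le> ?n - 1 \<and> ?n - 1 < ?n \<and> separates H ?c E
         then refl_in H ` last_face \<delta> else last_face \<delta>)"
      using gal(1)[OF \<delta>] fold_range[of \<delta>] first_wall[OF \<delta>]
      by (intro refold[OF adj \<delta>]) (simp_all add: less_imp_le)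
    moreover have "0 \<le> ?n - 1 \<and> ?n - 1 < ?n" using gal(1)[OF \<delta>] by linarith
    ultimately obtain \<delta>' where \<delta>': "Gal E' \<delta>'"
      "last_face \<delta>' = (if separates H ?c E then refl_in H ` last_face \<delta> else last_face \<delta>)"
      by auto
    note c = alcove_uncut[OF gal(3)[OF \<delta>] H]
    \<comment> \<open>A last chamber on the side of \<open>E\<close> is not moved, but then its
      face, lying in the half-apartment of \<open>E'\<close>, is contained in \<open>H\<close> and
      equals its own reflection.\<close>
    have "last_face \<delta> \<subseteq> H" if "\<not> separates H ?c E"
    proof -
      have "separates H ?c E'" using that adjacent_separates[OF adj c] by blast
      then show ?thesis
        using half_apartment_uncut(2)[OF uncut(2) c] half gal(4)[OF \<delta>] by blast
    qed
    then have "last_face \<delta>' = refl_in H ` last_face \<delta>"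
      using \<delta>'(2) hyperplane_refl_fix[OF H] by auto
    then show ?thesis using \<delta>'(1) by blast
  qed
  have backward: "\<exists>\<delta>'. Gal E \<delta>' \<and> (last_face \<delta>' = last_face \<delta> \<or>
      last_face \<delta>' = refl_in H ` last_face \<delta> \<and> refl_in H ` last_face \<delta> \<subseteq> half_apartment H E')"
    if \<delta>: "Gal E' \<delta>" for \<delta>
  proof -
    let ?n = "length (chambers \<delta>)"
    let ?c = "chambers \<delta> ! (?n - 1)"
    \<comment> \<open>The default \<open>?n\<close> places the interval beyond the gallery when
      there is no folding at \<open>H\<close>. The right end \<open>?n + 1\<close> used below keeps
      \<open>a\<close> smaller than it in that case too.\<close>
    define a where "a = (if \<exists>i. folded_in \<delta> H i then LEAST i. folded_in \<delta> H i else ?n)"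
    have a: "folded_in \<delta> H a" if "\<exists>i. folded_in \<delta> H i"
      unfolding a_def using that LeastI_ex[OF that] by simp
    have a_le: "a \<le> i" if "folded_in \<delta> H i" for i
    proof -
      have "a = (LEAST i. folded_in \<delta> H i)" unfolding a_def using that by auto
      then show ?thesis using Least_le[of "folded_in \<delta> H" i] that by simp
    qed
    have a_fold: "folded_in \<delta> H a \<or> a = ?n" using a unfolding a_def by auto
    \<comment> \<open>\<open>first_wall\<close> speaks of \<open>E\<close> only, so in this
      direction the interval has to start after 0, where the first chamber is left alone.\<close>
    then have "0 < a" "a \<le> ?n" using fold_range[of \<delta> a] gal(1)[OF \<delta>] by auto
    have "\<exists>\<delta>'. Gal E \<delta>' \<and> last_face \<delta>' =
        (if a \<le> ?n - 1 \<and> ?n - 1 < ?n + 1 \<and> separates H ?c E'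
         then refl_in H ` last_face \<delta> else last_face \<delta>)"
    proof (rule refold[OF adj' \<delta>])
      show "a \<le> i \<and> i \<le> ?n + 1" if "folded_in \<delta> H i" for i
        using a_le[OF that] fold_range[OF that] by linarith
    qed (use \<open>0 < a\<close> \<open>a \<le> ?n\<close> a_fold in auto)
    then obtain \<delta>' where \<delta>': "Gal E \<delta>'"
      "last_face \<delta>' = (if a \<le> ?n - 1 \<and> ?n - 1 < ?n + 1 \<and> separates H ?c E'
         then refl_in H ` last_face \<delta> else last_face \<delta>)" by blast
    \<comment> \<open>A moved last chamber lands on the side of \<open>E'\<close>, so the new last
      face belongs to the half-apartment, and the original face is its reflection.\<close>
    have "refl_in H ` last_face \<delta> \<subseteq> half_apartment H E'" if "separates H ?c E'"
    proof -
      have "separates H (refl_in H ` ?c) E"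
        using adjacent_refl_separates[OF adj' that] hyperplane_refl_fix[OF H order_refl] by simp
      then have "\<not> separates H (refl_in H ` ?c) E'"
        using adjacent_separates[OF adj] alcove_uncut[OF W_alcoves[OF r gal(3)[OF \<delta>]] H] by blast
      then have "refl_in H ` ?c \<subseteq> half_apartment H E'"
        using half_apartment_uncut(1)[OF uncut(2)] alcove_uncut[OF W_alcoves[OF r gal(3)[OF \<delta>]] H]
        by blast
      then show ?thesis using image_mono[OF gal(4)[OF \<delta>], of "refl_in H"] by blast
    qed
    then show ?thesis using \<delta>' by (intro exI[of _ \<delta>']) auto
  qed
  define A where "A = {last_face \<delta> | \<delta>. Gal E \<delta>}"
  define A' where "A' = {last_face \<delta> | \<delta>. Gal E' \<delta>}"
  have "A' \<subseteq> A \<union> (\<lambda>F. refl_in H ` F) ` {F \<in> A. F \<subseteq> half_apartment H E'}"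
  proof
    fix F assume "F \<in> A'"
    then obtain \<delta> where \<delta>: "Gal E' \<delta>" "F = last_face \<delta>" unfolding A'_def by blast
    from backward[OF this(1)] have "F \<in> A \<or> refl_in H ` F \<in> {F \<in> A. F \<subseteq> half_apartment H E'}"
      unfolding A_def \<delta>(2) by force
    moreover have "F = refl_in H ` refl_in H ` F" using hyperplane_refl_refl[OF H] by simp
    ultimately show "F \<in> A \<union> (\<lambda>F. refl_in H ` F) ` {F \<in> A. F \<subseteq> half_apartment H E'}" by blast
  qed
  moreover have "A \<subseteq> A'"
  proof
    fix F assume "F \<in> A"
    then obtain \<delta> where "Gal E \<delta>" "F = last_face \<delta>" unfolding A_def by blast
    then show "F \<in> A'" using keep[of \<delta>] unfolding A'_def by force
  qed
  moreover have "refl_in H ` F \<in> A'" if F: "F \<in> A" "F \<subseteq> half_apartment H E'" for F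
  proof -
    obtain \<delta> where "Gal E \<delta>" "F = last_face \<delta>" using F(1) unfolding A_def by blast
    then show ?thesis using reflected[of \<delta>] F(2) unfolding A'_def by force
  qed
  ultimately show ?thesis
    unfolding sh E'_def[symmetric] A_def[symmetric] A'_def[symmetric]
    by (intro equalityI Un_least image_subsetI) auto
qed

end

theorem theorem4p8:
  fixes \<Phi> \<Delta> :: "'a::euclidean_space set" and \<theta> :: 'a
    and x y s :: "'a \<Rightarrow> 'a" and \<sigma> \<tau> H :: "'a set" and \<gamma> :: "'a gallery"
  assumes "root_system \<Phi>" and "crystallographic \<Phi>" and "irreducible_roots \<Phi>"
    and "simple_roots \<Phi> \<Delta>" and "highest_root \<Phi> \<Delta> \<theta>"
    and "x \<in> affine_weyl_group \<Delta> \<theta>"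
    and "\<sigma> face_of fund_alcove \<Delta> \<theta>" and "0 \<in> \<sigma>"
    and "\<tau> face_of fund_alcove \<Delta> \<theta>" and "0 \<in> \<tau>"
    and "minimal_gallery \<Phi> \<gamma>" and "first_face \<gamma> = \<sigma>" and "last_face \<gamma> = x ` \<tau>"
    and "y \<in> affine_weyl_group \<Delta> \<theta>" and "s \<in> simple_refls \<Delta> \<theta>"
    and "coxeter_length \<Delta> \<theta> (y \<circ> s) > coxeter_length \<Delta> \<theta> y"
  defines "H \<equiv> separating_hyperplane \<Phi> ((y \<circ> s) ` fund_alcove \<Delta> \<theta>) (y ` fund_alcove \<Delta> \<theta>)"
  shows "shadow \<Phi> \<Delta> \<theta> \<gamma> (y \<circ> s) =
           shadow \<Phi> \<Delta> \<theta> \<gamma> y \<union>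
           (\<lambda>F. refl_in H ` F) `
             {F \<in> shadow \<Phi> \<Delta> \<theta> \<gamma> y.
                F \<subseteq> half_apartment H ((y \<circ> s) ` fund_alcove \<Delta> \<theta>)}"
proof -
  interpret affine_roots \<Phi> \<Delta> \<theta>
    using assms(1,2,4,5) by unfold_locales
  have "first_face \<gamma> \<subseteq> cf"
    using assms(7,12) face_of_imp_subset by blast
  then show ?thesis
    unfolding H_def by (rule shadow_ascent[OF assms(14-16)])
qed

end
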